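(* Let $d$ be a positive rational number such that $\sqrt d\notin\mathbb{Q}$. There exist constants $\eta_d>0$, $\kappa_d>0$ and $N_d$, depending only on $d$, such that for every convergent $\alpha/\beta$ (with $\alpha,\beta$ positive coprime integers) of the continued fraction expansion of $\sqrt d$ with $\alpha,\beta\ge N_d$, we have $$\left|\sqrt d-\frac{n}{\alpha^m}\right|\ge\frac{1}{(\eta_d\alpha)^m}\quad\text{and}\quad\left|\sqrt d-\frac{n}{\beta^m}\right|\ge\frac{1}{(\kappa_d\beta)^m}$$ for every $n\in\mathbb{Z}$ and every integer $m$ sufficiently large in terms of $d,\alpha,\beta$. *)

theory Defs
  imports Complex_Main
begin

fun cf_rem :: "real \<Rightarrow> nat \<Rightarrow> real" where
  "cf_rem x 0 = x"
| "cf_rem x (Suc k) = 1 / (cf_rem x k - of_int \<lfloor>cf_rem x k\<rfloor>)"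

definition cf_a :: "real \<Rightarrow> nat \<Rightarrow> int" where
  "cf_a x k = \<lfloor>cf_rem x k\<rfloor>"

fun cf_p :: "real \<Rightarrow> nat \<Rightarrow> int" where
  "cf_p x 0 = cf_a x 0"
| "cf_p x (Suc 0) = cf_a x 1 * cf_a x 0 + 1"
| "cf_p x (Suc (Suc k)) = cf_a x (k + 2) * cf_p x (Suc k) + cf_p x k"

fun cf_q :: "real \<Rightarrow> nat \<Rightarrow> int" where
  "cf_q x 0 = 1"
| "cf_q x (Suc 0) = cf_a x 1"
| "cf_q x (Suc (Suc k)) = cf_a x (k + 2) * cf_q x (Suc k) + cf_q x k"

definition is_cf_convergent :: "real \<Rightarrow> int \<Rightarrow> int \<Rightarrow> bool" where
  "is_cf_convergent x a b \<longleftrightarrow> (\<exists>k. real_of_int a / real_of_int b = real_of_int (cf_p x k) / real_of_int (cf_q x k))"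

end

theory Submission
  imports Defs "HOL-Computational_Algebra.Polynomial"
begin

text \<open>
  Write \<open>d = a / b\<close>. For a convergent \<open>\<alpha> / \<beta>\<close> of \<open>sqrt d\<close> the integer \<open>u = a \<beta>\<^sup>2 - b \<alpha>\<^sup>2\<close> is bounded
  in terms of \<open>d\<close>, and \<open>sqrt d = (\<alpha> / \<beta>) sqrt w\<close> with \<open>w = 1 + u / (b \<alpha>\<^sup>2)\<close> close to 1 (similarly for
  \<open>\<beta>\<close>). Non-diagonal Pade approximants \<open>A(w) + sqrt w B(w)\<close> of degrees \<open>s > t\<close> arise as the
  divided difference of \<open>e \<mapsto> w powr e\<close> at the nodes \<open>0, \<dots>, s, 1/2, \<dots>, t + 1/2\<close>, so they are of size
  \<open>O(\<bar>w - 1\<bar>)^(s + t + 1)\<close>. After clearing denominators the coefficient of \<open>sqrt w\<close> is divisible by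
  \<open>\<alpha>^(2 (s - t))\<close>. Taking \<open>2 (s - t)\<close> about \<open>m\<close>, the comparison with \<open>n / \<alpha>^m\<close> produces a nonzero
  integer divisible by about \<open>\<alpha>^m\<close>, and \<open>\<alpha>^t\<close> of exponential size in \<open>m\<close> (with base depending only on
  \<open>d\<close>) suffices to make the approximation error negligible. Two consecutive values of \<open>s\<close> guarantee
  that the integer does not vanish.
\<close>

section \<open>Divided differences of the exponential function\<close>

text \<open>This is the divided difference of the constant function 1. Multiplying the sum by
  \<open>x - y\<close> for two nodes turns it into the difference of the sums with \<open>y\<close>
  and with \<open>x\<close> deleted. These vanish by induction, or both equal 1 when there are only
  two nodes.\<close>

lemma sum_inverse_node_products_eq_0:
  fixes I :: "real set"
  assumes "finite I" "card I \<ge> 2"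
  shows "(\<Sum>a\<in>I. 1 / (\<Prod>b\<in>I - {a}. a - b)) = 0"
  using assms
proof (induction "card I" arbitrary: I rule: less_induct)
  case less
  define S where "S = (\<lambda>J::real set. \<Sum>a\<in>J. 1 / (\<Prod>b\<in>J - {a}. a - b))"
  obtain x y where xy: "x \<in> I" "y \<in> I" "x \<noteq> y"
    using less.prems by (metis card_le_Suc0_iff_eq not_less_eq_eq numeral_2_eq_2)
  \<comment> \<open>Deleting the node \<open>z\<close> multiplies the term of \<open>a\<close> by
    \<open>a - z\<close>; the term with \<open>a = z\<close> becomes zero and may stay in the
    sum.\<close>
  have remove: "S (I - {z}) = (\<Sum>a\<in>I. (a - z) / (\<Prod>b\<in>I - {a}. a - b))" if "z \<in> I" for z
  proof -
    have "S (I - {z}) = (\<Sum>a\<in>I - {z}. (a - z) / (\<Prod>b\<in>I - {a}. a - b))"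
      unfolding S_def
    proof (rule sum.cong[OF refl])
      fix a assume a: "a \<in> I - {z}"
      have "(\<Prod>b\<in>I - {a}. a - b) = (a - z) * (\<Prod>b\<in>I - {a} - {z}. a - b)"
        using a that less.prems by (intro prod.remove) auto
      moreover have "I - {a} - {z} = I - {z} - {a}" by auto
      ultimately show "1 / (\<Prod>b\<in>I - {z} - {a}. a - b) = (a - z) / (\<Prod>b\<in>I - {a}. a - b)"
        using a by simp
    qed
    also have "\<dots> = (\<Sum>a\<in>I. (a - z) / (\<Prod>b\<in>I - {a}. a - b))"
      using less.prems that by (intro sum.mono_neutral_left) auto
    finally show ?thesis .
  qed
  have "(x - y) * S I = S (I - {y}) - S (I - {x})"
    unfolding remove[OF xy(1)] remove[OF xy(2)] unfolding S_def sum_distrib_left sum_subtractf[symmetric]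
    by (intro sum.cong) (auto simp: diff_divide_distrib[symmetric])
  also have "\<dots> = 0"
  proof (cases "card I = 2")
    case True
    then have "I = {x, y}" using xy less.prems
      by (metis card_2_iff insertE singletonD doubleton_eq_iff)
    then have "I - {x} = {y}" "I - {y} = {x}" using xy by auto
    then show ?thesis by (simp add: S_def)
  next
    case False
    have c: "card (I - {z}) = card I - 1" if "z \<in> I" for z using that less.prems by simp
    have "S (I - {z}) = 0" if "z \<in> I" for z
      unfolding S_def
      using less.prems False that by (intro less.hyps) (auto simp: c)
    then show ?thesis using xy by simp
  qed
  finally show ?case using xy by (simp add: S_def)
qed

text \<open>Lagrange form of the divided difference of \<open>e \<mapsto> exp (e * x)\<close> over
  the nodes in \<open>I\<close>; for \<open>x = ln w\<close> it is that of
  \<open>w powr e\<close>.\<close>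

definition exp_divdiff :: "real set \<Rightarrow> real \<Rightarrow> real" where
  "exp_divdiff I x = (\<Sum>a\<in>I. exp (a * x) / (\<Prod>b\<in>I - {a}. a - b))"

lemma exp_divdiff_0: "finite I \<Longrightarrow> card I \<ge> 2 \<Longrightarrow> exp_divdiff I 0 = 0"
  using sum_inverse_node_products_eq_0[of I] by (simp add: exp_divdiff_def)

text \<open>After multiplication by \<open>exp (- c * x)\<close>, differentiation puts a factor
  \<open>a - c\<close> on the term of \<open>a\<close>, which cancels the node \<open>c\<close> from
  its denominator. This makes induction on the number of nodes possible.\<close>

lemma DERIV_exp_mult_exp_divdiff:
  assumes "finite I" "c \<in> I"
  shows "((\<lambda>x. exp (- c * x) * exp_divdiff I x) has_real_derivative
           exp (- c * x) * exp_divdiff (I - {c}) x) (at x)"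
proof -
  let ?P = "\<lambda>J a. \<Prod>b\<in>J - {a}. a - b"
  have *: "(exp_divdiff I has_real_derivative (\<Sum>a\<in>I. a * exp (a * x) / ?P I a)) (at x)"
    unfolding exp_divdiff_def
    by (intro DERIV_sum DERIV_cdivide) (auto intro!: derivative_eq_intros)
  have "exp_divdiff (I - {c}) x = (\<Sum>a\<in>I - {c}. (a - c) * exp (a * x) / ?P I a)"
    unfolding exp_divdiff_def
  proof (rule sum.cong[OF refl])
    fix a assume a: "a \<in> I - {c}"
    have "?P I a = (a - c) * (\<Prod>b\<in>I - {a} - {c}. a - b)"
      using a assms by (intro prod.remove) auto
    moreover have "I - {a} - {c} = I - {c} - {a}" by auto
    ultimately show "exp (a * x) / ?P (I - {c}) a = (a - c) * exp (a * x) / ?P I a"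
      using a by simp
  qed
  also have "\<dots> = (\<Sum>a\<in>I. (a - c) * exp (a * x) / ?P I a)"
    using assms by (intro sum.mono_neutral_left) auto
  also have "\<dots> = (\<Sum>a\<in>I. a * exp (a * x) / ?P I a) - c * exp_divdiff I x"
    unfolding exp_divdiff_def sum_distrib_left sum_subtractf[symmetric]
    by (intro sum.cong) (auto simp: left_diff_distrib diff_divide_distrib)
  finally have eq: "exp_divdiff (I - {c}) x = (\<Sum>a\<in>I. a * exp (a * x) / ?P I a) - c * exp_divdiff I x" .
  show ?thesis
    unfolding eq
    by (rule derivative_eq_intros * refl | simp add: algebra_simps)+
qed

text \<open>A mean value formula \<open>x ^ N / fact N * exp (\<xi> * x)\<close> would give the same
  bounds. Here they come by induction: up to exponential factors, removing a node \<open>c\<close>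
  is differentiation, and both inequalities integrate from 0, where a divided difference over at
  least two nodes vanishes.\<close>

lemma exp_divdiff_bounds:
  assumes "finite I" "card I = Suc N" "\<And>a. a \<in> I \<Longrightarrow> a \<le> E" "x \<ge> 0"
  shows "0 \<le> exp_divdiff I x \<and> exp_divdiff I x \<le> x ^ N / fact N * exp (E * x)"
  using assms
proof (induction N arbitrary: I x)
  case 0
  then obtain a where "I = {a}" by (metis One_nat_def card_1_singletonE)
  with 0 show ?case by (auto simp: exp_divdiff_def intro!: mult_right_mono)
next
  case (Suc N)
  then obtain c where c: "c \<in> I" by fastforce
  have IH: "0 \<le> exp_divdiff (I - {c}) y \<and> exp_divdiff (I - {c}) y \<le> y ^ N / fact N * exp (E * y)"
    if "y \<ge> 0" for y
    using Suc.prems c that by (intro Suc.IH) auto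
  define G where "G = (\<lambda>y. exp (- c * y) * exp_divdiff I y)"
  \<comment> \<open>The gap in the upper bound, multiplied by \<open>exp (- c * y)\<close>. It
    vanishes at 0, and its derivative is nonnegative by the induction hypothesis and
    \<open>c \<le> E\<close>.\<close>
  define K where "K = (\<lambda>y. y ^ Suc N / fact (Suc N) * exp ((E - c) * y) - G y)"
  have zero: "exp_divdiff I 0 = 0" using Suc.prems by (intro exp_divdiff_0) auto
  have G': "(G has_real_derivative exp (- c * y) * exp_divdiff (I - {c}) y) (at y)" for y
    unfolding G_def using DERIV_exp_mult_exp_divdiff[OF Suc.prems(1) c] .
  have "G 0 \<le> G x"
    using G' IH by (intro DERIV_nonneg_imp_nondecreasing[OF Suc.prems(4)]) (metis exp_ge_zero mult_nonneg_nonneg)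
  then have lower: "exp_divdiff I x \<ge> 0" by (simp add: G_def zero zero_le_mult_iff)
  have D: "((\<lambda>y. y ^ Suc N / fact (Suc N)) has_real_derivative y ^ N / fact N) (at y)" for y :: real
    using DERIV_cdivide[OF DERIV_pow[of "Suc N" y], of "fact (Suc N)"]
    by (simp add: divide_simps split: if_splits)
  have K': "(K has_real_derivative
      (y ^ N / fact N * exp ((E - c) * y) + (E - c) * exp ((E - c) * y) * (y ^ Suc N / fact (Suc N))
       - exp (- c * y) * exp_divdiff (I - {c}) y)) (at y)" for y
    unfolding K_def
    by (rule derivative_eq_intros D G' refl | simp)+
  have "K 0 \<le> K x"
  proof (rule DERIV_nonneg_imp_nondecreasing[OF Suc.prems(4)])
    fix y assume y: "0 \<le> y" "y \<le> x"
    have "exp (- c * y) * exp_divdiff (I - {c}) y \<le> exp (- c * y) * (y ^ N / fact N * exp (E * y))"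
      using IH[OF y(1)] by (intro mult_left_mono) auto
    also have "\<dots> = y ^ N / fact N * exp ((E - c) * y)"
      by (simp add: left_diff_distrib exp_diff exp_minus field_simps)
    finally have "exp (- c * y) * exp_divdiff (I - {c}) y \<le> y ^ N / fact N * exp ((E - c) * y)" .
    moreover have "(E - c) * exp ((E - c) * y) * (y ^ Suc N / fact (Suc N)) \<ge> 0"
      using Suc.prems(3)[OF c] y by (intro mult_nonneg_nonneg) auto
    ultimately show "\<exists>z. (K has_real_derivative z) (at y) \<and> 0 \<le> z"
      using K'[of y] by (intro exI conjI) (assumption, linarith)
  qed
  then have "exp (- c * x) * exp_divdiff I x \<le> x ^ Suc N / fact (Suc N) * exp ((E - c) * x)"
    by (simp add: K_def G_def zero)
  also have "\<dots> = exp (- c * x) * (x ^ Suc N / fact (Suc N) * exp (E * x))"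
    by (simp add: left_diff_distrib exp_diff exp_minus field_simps)
  finally have "exp_divdiff I x \<le> x ^ Suc N / fact (Suc N) * exp (E * x)"
    using mult_le_cancel_left_pos exp_gt_zero by blast
  with lower show ?case by blast
qed

text \<open>Reflecting nodes and argument fixes the exponentials and flips the \<open>N\<close>
  factors of every denominator. This reduces negative \<open>x\<close> to the one-sided
  bounds.\<close>

lemma exp_divdiff_uminus:
  assumes "finite I" "card I = Suc N"
  shows "exp_divdiff (uminus ` I) (- x) = (- 1) ^ N * exp_divdiff I x"
proof -
  have "exp_divdiff (uminus ` I) (- x) = (\<Sum>a\<in>I. exp (a * x) / (\<Prod>b\<in>uminus ` I - {- a}. - a - b))"
    unfolding exp_divdiff_def by (subst sum.reindex) auto
  also have "\<dots> = (\<Sum>a\<in>I. (- 1) ^ N * (exp (a * x) / (\<Prod>b\<in>I - {a}. a - b)))"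
  proof (rule sum.cong[OF refl])
    fix a assume a: "a \<in> I"
    have "(\<Prod>b\<in>uminus ` I - {- a}. - a - b) = (\<Prod>b\<in>uminus ` (I - {a}). - a - b)"
      by (intro prod.cong) auto
    also have "\<dots> = (\<Prod>b\<in>I - {a}. - 1 * (a - b))"
      by (subst prod.reindex) (auto intro!: prod.cong)
    also have "\<dots> = (- 1) ^ N * (\<Prod>b\<in>I - {a}. a - b)"
      using a assms by (subst prod.distrib) simp
    finally show "exp (a * x) / (\<Prod>b\<in>uminus ` I - {- a}. - a - b)
        = (- 1) ^ N * (exp (a * x) / (\<Prod>b\<in>I - {a}. a - b))"
      by (cases "even N") auto
  qed
  finally show ?thesis by (simp add: exp_divdiff_def sum_distrib_left)
qed

lemma abs_exp_divdiff_le: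
  assumes "finite I" "card I = Suc N" "\<And>a. a \<in> I \<Longrightarrow> \<bar>a\<bar> \<le> E"
  shows "\<bar>exp_divdiff I x\<bar> \<le> \<bar>x\<bar> ^ N / fact N * exp (E * \<bar>x\<bar>)"
proof (cases "x \<ge> 0")
  case True
  then show ?thesis using exp_divdiff_bounds[of I N E x] assms by fastforce
next
  case False
  have "card (uminus ` I) = Suc N" using assms by (simp add: card_image)
  then have "\<bar>exp_divdiff (uminus ` I) (- x)\<bar> \<le> \<bar>x\<bar> ^ N / fact N * exp (E * \<bar>x\<bar>)"
    using exp_divdiff_bounds[of "uminus ` I" N E "- x"] assms False by fastforce
  then show ?thesis unfolding exp_divdiff_uminus[OF assms(1,2)] by (simp add: abs_mult)
qed

section \<open>Pade approximants of the square root\<close>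

text \<open>For the upper argument \<open>- 1 / 2\<close> the number is, up to sign, a central
  binomial coefficient. Pascal's rule carries integrality from \<open>c\<close> to
  \<open>c + 1\<close> and \<open>c - 1\<close>, because the correction term has lower index
  \<open>k\<close> and is integral for every \<open>c\<close> by the outer induction.\<close>

lemma half_gchoose_Ints:
  "4 ^ k * ((of_int c - 1 / 2 :: real) gchoose k) \<in> \<int>"
proof (induction k arbitrary: c)
  case 0
  then show ?case by simp
next
  case (Suc k)
  let ?f = "\<lambda>c::int. 4 ^ Suc k * ((of_int c - 1 / 2 :: real) gchoose Suc k)"
  have step: "?f (c + 1) = ?f c + 4 * (4 ^ k * ((of_int c - 1 / 2 :: real) gchoose k))" for c
    using gbinomial_Suc_Suc[of "of_int c - 1 / 2 :: real" k] by (simp add: algebra_simps)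
  have base: "?f 0 \<in> \<int>"
  proof -
    have "4 ^ n * ((- 1 / 2 :: real) gchoose n) = (- 1) ^ n * of_nat (2 * n choose n)" for n
    proof (induction n)
      case (Suc n)
      have "(- 1 / 2 :: real) gchoose Suc n = (- 1 / 2 - n) / (Suc n) * ((- 1 / 2 :: real) gchoose n)"
        using gbinomial_mult_1[of "- 1 / 2 :: real" n] by (simp add: field_simps)
      then have "4 ^ Suc n * ((- 1 / 2 :: real) gchoose Suc n) = 4 * (- 1 / 2 - n) / (Suc n) * (4 ^ n * ((- 1 / 2 :: real) gchoose n))"
        by simp
      also have "\<dots> = (- 1) ^ Suc n * (2 * (2 * n + 1) / (n + 1) * of_nat (2 * n choose n))"
        unfolding Suc.IH by (simp add: field_simps)
      also have "2 * (2 * n + 1) / (n + 1) * of_nat (2 * n choose n) = real (2 * Suc n choose Suc n)"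
      proof -
        have a: "real (2 * n choose n) = fact (2 * n) / (fact n * fact n)"
          using binomial_fact[of n "2 * n", where ?'a = real] by simp
        have b: "real (2 * Suc n choose Suc n) = fact (2 * Suc n) / (fact (Suc n) * fact (Suc n))"
          using binomial_fact[of "Suc n" "2 * Suc n", where ?'a = real] by simp
        have c: "fact (2 * Suc n) = (2 * real n + 2) * ((2 * real n + 1) * fact (2 * n))"
          by (simp add: algebra_simps)
        have "2 * (2 * x + 1) / (x + 1) * (F / (f * f)) =
            (2 * x + 2) * ((2 * x + 1) * F) / (((x + 1) * f) * ((x + 1) * f))"
          if "f \<noteq> 0" "x + 1 \<noteq> 0" for x F f :: real
          using that by (simp add: divide_simps) (simp add: algebra_simps)
        from this[of "fact n" "real n" "fact (2 * n)"] show ?thesis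
          unfolding a b c by (simp add: algebra_simps)
      qed
      finally show ?case .
    qed simp
    from this[of "Suc k"] show ?thesis by simp
  qed
  show ?case
  proof (induction c rule: int_induct[of _ 0])
    case base
    show ?case by (fact base)
  next
    case (step1 i)
    then show ?case unfolding step using Suc.IH[of i] by simp
  next
    case (step2 i)
    have "?f (i - 1) = ?f i - 4 * (4 ^ k * ((of_int (i - 1) - 1 / 2 :: real) gchoose k))"
      using step[of "i - 1"] by simp
    then show ?case using step2 Suc.IH[of "i - 1"] by simp
  qed
qed

lemma half_pochhammer_Ints:
  assumes "x + 1 / 2 \<in> \<int>"
  shows "4 ^ k * (pochhammer (x :: real) k / fact k) \<in> \<int>"
proof -
  obtain c where c: "x + 1 / 2 = of_int c" using assms by (auto elim: Ints_cases)
  have "pochhammer x k / fact k = (of_int (c + int k - 1) - 1 / 2 :: real) gchoose k"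
  proof -
    have "x = of_int (c + int k - 1) - 1 / 2 - real k + 1" using c by simp
    then show ?thesis unfolding gbinomial_pochhammer' by simp
  qed
  then show ?thesis using half_gchoose_Ints[of k "c + int k - 1"] by simp
qed

text \<open>Factor by factor the symbol is dominated by the rising factorial of \<open>E\<close>,
  hence by that of \<open>E + 1\<close>, which divided by \<open>fact k\<close> is the binomial
  coefficient \<open>(E + k) choose k\<close>.\<close>

lemma abs_pochhammer_div_fact_le:
  fixes x :: real
  assumes "\<bar>x\<bar> \<le> real E"
  shows "\<bar>pochhammer x k / fact k\<bar> \<le> 2 ^ (E + k)"
proof -
  have "\<bar>pochhammer x k\<bar> \<le> pochhammer (real E) k"
    unfolding pochhammer_prod abs_prod using assms by (intro prod_mono) auto
  then have "\<bar>pochhammer x k / fact k\<bar> \<le> pochhammer (real E) k / fact k"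
    by (simp add: divide_right_mono)
  also have "\<dots> \<le> real ((E + k) choose k)"
  proof -
    have "pochhammer (real E) k \<le> pochhammer (real E + 1) k"
      unfolding pochhammer_prod by (intro prod_mono) auto
    then show ?thesis
      unfolding binomial_gbinomial gbinomial_pochhammer' by (simp add: divide_right_mono)
  qed
  also have "\<dots> \<le> 2 ^ (E + k)"
    using binomial_le_pow2[of "E + k" k] by (metis of_nat_le_iff of_nat_numeral of_nat_power)
  finally show ?thesis .
qed

section \<open>Nodes, node products and coefficients\<close>

text \<open>In \<open>exp (a * ln w)\<close> the integer nodes yield powers of \<open>w\<close>, and
  the half-integer nodes yield \<open>sqrt w\<close> times powers of \<open>w\<close>.\<close>

definition sqrt_nodes :: "nat \<Rightarrow> nat \<Rightarrow> real set" where
  "sqrt_nodes s t = real ` {..s} \<union> (\<lambda>j. real j + 1 / 2) ` {..t}"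

lemma real_neq_half: "real i \<noteq> real j + 1 / 2"
proof
  assume "real i = real j + 1 / 2"
  then have "real (2 * i) = real (2 * j + 1)" by simp
  then have "2 * i = 2 * j + 1" unfolding of_nat_eq_iff .
  then show False by presburger
qed

lemma half_neq_real: "real j + 1 / 2 \<noteq> real i"
  using real_neq_half[of i j] by simp

lemma finite_sqrt_nodes [simp]: "finite (sqrt_nodes s t)"
  by (simp add: sqrt_nodes_def)

lemma card_sqrt_nodes: "card (sqrt_nodes s t) = Suc (s + t + 1)"
proof -
  have "real ` {..s} \<inter> (\<lambda>j. real j + 1 / 2) ` {..t} = {}" using real_neq_half by auto
  then have "card (sqrt_nodes s t) = card (real ` {..s}) + card ((\<lambda>j. real j + 1 / 2) ` {..t})"
    unfolding sqrt_nodes_def by (intro card_Un_disjoint) auto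
  then show ?thesis by (simp add: card_image inj_on_def)
qed

lemma prod_int_nodes:
  assumes "i \<le> s"
  shows "(\<Prod>k\<in>{..s} - {i}. real i - real k) = (- 1) ^ (s - i) * fact i * fact (s - i)"
proof -
  have split: "{..s} - {i} = {..<i} \<union> {i<..s}" using assms by auto
  have "(\<Prod>k\<in>{..s} - {i}. real i - real k) = (\<Prod>k<i. real i - real k) * (\<Prod>k\<in>{i<..s}. real i - real k)"
    unfolding split by (rule prod.union_disjoint) auto
  also have "(\<Prod>k<i. real i - real k) = fact i"
    by (simp add: fact_prod_rev atLeast0LessThan of_nat_diff)
  also have "(\<Prod>k\<in>{i<..s}. real i - real k) = (\<Prod>k=1..s-i. - 1 * real k)"
    using assms by (intro prod.reindex_bij_witness[of _ "\<lambda>k. k + i" "\<lambda>k. k - i"]) (auto simp: of_nat_diff)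
  also have "\<dots> = (- 1) ^ (s - i) * fact (s - i)"
    unfolding prod.distrib fact_prod by simp
  finally show ?thesis by simp
qed

lemma prod_sqrt_nodes_int:
  assumes "i \<le> s"
  shows "(\<Prod>b\<in>sqrt_nodes s t - {real i}. real i - b) =
     (- 1) ^ (s - i + t + 1) * fact i * fact (s - i) * pochhammer (1 / 2 - real i) (t + 1)"
proof -
  have "sqrt_nodes s t - {real i} = real ` ({..s} - {i}) \<union> (\<lambda>j. real j + 1 / 2) ` {..t}"
    unfolding sqrt_nodes_def using real_neq_half[of i] by auto
  moreover have "real ` ({..s} - {i}) \<inter> (\<lambda>j. real j + 1 / 2) ` {..t} = {}" using real_neq_half by auto
  ultimately have "(\<Prod>b\<in>sqrt_nodes s t - {real i}. real i - b) =
      (\<Prod>k\<in>{..s} - {i}. real i - real k) * (\<Prod>j\<le>t. real i - (real j + 1 / 2))"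
    by (simp add: prod.union_disjoint prod.reindex inj_on_def)
  also have "(\<Prod>j\<le>t. real i - (real j + 1 / 2)) = (\<Prod>j\<le>t. - 1 * (1 / 2 - real i + real j))"
    by (intro prod.cong) auto
  also have "\<dots> = (- 1) ^ (t + 1) * pochhammer (1 / 2 - real i) (t + 1)"
    unfolding prod.distrib by (simp add: pochhammer_Suc_prod atLeast0AtMost)
  finally show ?thesis unfolding prod_int_nodes[OF assms] by (simp add: power_add)
qed

lemma prod_sqrt_nodes_half:
  assumes "j \<le> t"
  shows "(\<Prod>b\<in>sqrt_nodes s t - {real j + 1 / 2}. real j + 1 / 2 - b) =
     (- 1) ^ (t - j) * fact (t - j) * fact j * pochhammer (1 / 2 - real s + real j) (s + 1)"
proof -
  have "sqrt_nodes s t - {real j + 1 / 2} = (\<lambda>j. real j + 1 / 2) ` ({..t} - {j}) \<union> real ` {..s}"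
    unfolding sqrt_nodes_def using half_neq_real[of j] by auto
  moreover have "(\<lambda>j. real j + 1 / 2) ` ({..t} - {j}) \<inter> real ` {..s} = {}" using half_neq_real by fastforce
  ultimately have "(\<Prod>b\<in>sqrt_nodes s t - {real j + 1 / 2}. real j + 1 / 2 - b) =
      (\<Prod>k\<in>{..t} - {j}. real j - real k) * (\<Prod>i\<le>s. real j + 1 / 2 - real i)"
    by (simp add: prod.union_disjoint prod.reindex inj_on_def)
  also have "(\<Prod>i\<le>s. real j + 1 / 2 - real i) = (\<Prod>i\<le>s. 1 / 2 - real s + real j + real i)"
    by (intro prod.reindex_bij_witness[of _ "\<lambda>i. s - i" "\<lambda>i. s - i"]) (auto simp: of_nat_diff)
  also have "\<dots> = pochhammer (1 / 2 - real s + real j) (s + 1)"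
    by (simp add: pochhammer_Suc_prod atLeast0AtMost)
  finally show ?thesis unfolding prod_int_nodes[OF assms] by simp
qed

text \<open>With this numerator the denominators cancel up to powers of 4: the node product of each \<open>a\<close>
  is \<open>\<plusminus>\<close> two factorials times a block of consecutive factors of the Pochhammer symbol.\<close>

definition sqrt_coeff :: "nat \<Rightarrow> nat \<Rightarrow> real \<Rightarrow> real" where
  "sqrt_coeff s t a = pochhammer (1 / 2 - real s) (s + t + 1) / (\<Prod>b\<in>sqrt_nodes s t - {a}. a - b)"

lemma half_pochhammer_nonzero: "pochhammer (1 / 2 - real s + real j) n \<noteq> 0"
proof
  assume "pochhammer (1 / 2 - real s + real j) n = 0"
  then obtain k where "1 / 2 - real s + real j = - real k" by (auto simp: pochhammer_eq_0_iff)
  then have "real s = real (j + k) + 1 / 2" by simp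
  then show False using real_neq_half by blast
qed

lemma sqrt_coeff_nonzero: "sqrt_coeff s t a \<noteq> 0"
proof -
  have "(\<Prod>b\<in>sqrt_nodes s t - {a}. a - b) \<noteq> 0" by simp
  moreover have "pochhammer (1 / 2 - real s) (s + t + 1) \<noteq> 0"
    using half_pochhammer_nonzero[of s 0] by simp
  ultimately show ?thesis by (simp add: sqrt_coeff_def)
qed

lemma signed_quotient_cancel:
  fixes x :: real
  assumes "x \<noteq> 0"
  shows "p * (x * y) / ((- 1) ^ n * a * b * x) = (- 1) ^ n * (p / b) * (y / a)"
  using assms by (cases "even n") simp_all

text \<open>The Pochhammer numerator is cut into blocks of lengths \<open>s - i\<close>,
  \<open>t + 1\<close> and \<open>i\<close>. The middle block cancels against the half-integer
  nodes; the outer ones pair with \<open>fact (s - i)\<close> and \<open>fact i\<close>.\<close>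

lemma sqrt_coeff_int:
  assumes "i \<le> s"
  shows "sqrt_coeff s t (real i) = (- 1) ^ (s - i + t + 1) *
    (pochhammer (1 / 2 - real s) (s - i) / fact (s - i)) *
    (pochhammer (1 / 2 - real i + real (t + 1)) i / fact i)"
proof -
  have "s + t + 1 = (s - i) + ((t + 1) + i)" using assms by simp
  then have "pochhammer (1 / 2 - real s) (s + t + 1) = pochhammer (1 / 2 - real s) (s - i) *
      (pochhammer (1 / 2 - real s + real (s - i)) (t + 1) *
       pochhammer (1 / 2 - real s + real (s - i) + real (t + 1)) i)"
    by (simp only: pochhammer_product')
  moreover have "1 / 2 - real s + real (s - i) = 1 / 2 - real i" using assms by (simp add: of_nat_diff)
  moreover have "pochhammer (1 / 2 - real i) (t + 1) \<noteq> 0" using half_pochhammer_nonzero[of i 0] by simp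
  ultimately show ?thesis
    unfolding sqrt_coeff_def prod_sqrt_nodes_int[OF assms]
    by (simp only:) (rule signed_quotient_cancel)
qed

text \<open>Now the blocks have lengths \<open>j\<close>, \<open>s + 1\<close> and
  \<open>t - j\<close>, and the middle one is the product over the integer nodes.\<close>

lemma sqrt_coeff_half:
  assumes "j \<le> t"
  shows "sqrt_coeff s t (real j + 1 / 2) = (- 1) ^ (t - j) *
    (pochhammer (1 / 2 - real s) j / fact j) *
    (pochhammer (1 / 2 - real s + real j + real (s + 1)) (t - j) / fact (t - j))"
proof -
  have "s + t + 1 = j + ((s + 1) + (t - j))" using assms by simp
  then have "pochhammer (1 / 2 - real s) (s + t + 1) = pochhammer (1 / 2 - real s) j *
      (pochhammer (1 / 2 - real s + real j) (s + 1) *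
       pochhammer (1 / 2 - real s + real j + real (s + 1)) (t - j))"
    by (simp only: pochhammer_product')
  moreover have "pochhammer (1 / 2 - real s + real j) (s + 1) \<noteq> 0" using half_pochhammer_nonzero .
  ultimately show ?thesis
    unfolding sqrt_coeff_def prod_sqrt_nodes_half[OF assms]
    by (simp only:) (rule signed_quotient_cancel)
qed

lemma sqrt_coeff_int_Ints:
  assumes "i \<le> s"
  shows "4 ^ (s + t + 1) * sqrt_coeff s t (real i) \<in> \<int>"
proof -
  let ?p = "pochhammer (1 / 2 - real s) (s - i) / fact (s - i)"
  let ?q = "pochhammer (1 / 2 - real i + real (t + 1)) i / fact i"
  have "1 / 2 - real s + 1 / 2 = of_int (1 - int s)" by simp
  then have 1: "4 ^ (s - i) * ?p \<in> \<int>" by (intro half_pochhammer_Ints) (metis Ints_of_int)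
  have "1 / 2 - real i + real (t + 1) + 1 / 2 = of_int (2 - int i + int t)" by simp
  then have 2: "4 ^ i * ?q \<in> \<int>" by (intro half_pochhammer_Ints) (metis Ints_of_int)
  \<comment> \<open>The two outer blocks use up \<open>4 ^ (s - i)\<close> and \<open>4 ^ i\<close>.
    The surplus \<open>4 ^ (t + 1)\<close> is kept so that one factor clears the coefficients of
    both kinds.\<close>
  have "4 ^ (s + t + 1) = (4::real) ^ (t + 1) * 4 ^ (s - i) * 4 ^ i"
    using assms by (simp flip: power_add)
  then have "4 ^ (s + t + 1) * sqrt_coeff s t (real i) =
      (- 1) ^ (s - i + t + 1) * 4 ^ (t + 1) * ((4 ^ (s - i) * ?p) * (4 ^ i * ?q))"
    unfolding sqrt_coeff_int[OF assms] by (simp only: mult_ac)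
  also have "\<dots> \<in> \<int>" by (intro Ints_mult 1 2 Ints_power) auto
  finally show ?thesis .
qed

lemma sqrt_coeff_half_Ints:
  assumes "j \<le> t"
  shows "4 ^ (s + t + 1) * sqrt_coeff s t (real j + 1 / 2) \<in> \<int>"
proof -
  let ?p = "pochhammer (1 / 2 - real s) j / fact j"
  let ?q = "pochhammer (1 / 2 - real s + real j + real (s + 1)) (t - j) / fact (t - j)"
  have "1 / 2 - real s + 1 / 2 = of_int (1 - int s)" by simp
  then have 1: "4 ^ j * ?p \<in> \<int>" by (intro half_pochhammer_Ints) (metis Ints_of_int)
  have "1 / 2 - real s + real j + real (s + 1) + 1 / 2 = of_int (2 + int j)" by simp
  then have 2: "4 ^ (t - j) * ?q \<in> \<int>" by (intro half_pochhammer_Ints) (metis Ints_of_int)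
  have "4 ^ (s + t + 1) = (4::real) ^ (s + 1) * 4 ^ j * 4 ^ (t - j)"
    using assms by (simp flip: power_add)
  then have "4 ^ (s + t + 1) * sqrt_coeff s t (real j + 1 / 2) =
      (- 1) ^ (t - j) * 4 ^ (s + 1) * ((4 ^ j * ?p) * (4 ^ (t - j) * ?q))"
    unfolding sqrt_coeff_half[OF assms] by (simp only: mult_ac)
  also have "\<dots> \<in> \<int>" by (intro Ints_mult 1 2 Ints_power) auto
  finally show ?thesis .
qed

lemma abs_sqrt_coeff_half_le:
  assumes "j \<le> t"
  shows "\<bar>sqrt_coeff s t (real j + 1 / 2)\<bar> \<le> 8 ^ (s + t + 1)"
proof -
  let ?p = "pochhammer (1 / 2 - real s) j / fact j"
  let ?q = "pochhammer (1 / 2 - real s + real j + real (s + 1)) (t - j) / fact (t - j)"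
  have "\<bar>?p\<bar> \<le> 2 ^ (s + 1 + j)" by (intro abs_pochhammer_div_fact_le) auto
  moreover have "\<bar>?q\<bar> \<le> 2 ^ (t + 2 + (t - j))"
    using assms by (intro abs_pochhammer_div_fact_le) auto
  ultimately have "\<bar>?p\<bar> * \<bar>?q\<bar> \<le> 2 ^ (s + 1 + j) * 2 ^ (t + 2 + (t - j))"
    by (intro mult_mono) auto
  also have "\<dots> \<le> 2 ^ (3 * (s + t + 1))"
    unfolding power_add[symmetric] using assms by (intro power_increasing) auto
  finally show ?thesis
    unfolding sqrt_coeff_half[OF assms] power_mult by (simp add: abs_mult)
qed

section \<open>The approximants, their remainder and their size\<close>

text \<open>The signs are such that numerator plus \<open>sqrt w\<close> times denominator is small
  near 1, so \<open>sqrt w\<close> is close to minus their quotient.\<close>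

definition sqrt_pade_num :: "nat \<Rightarrow> nat \<Rightarrow> real poly" where
  "sqrt_pade_num s t = (\<Sum>i\<le>s. monom (sqrt_coeff s t (real i)) i)"

definition sqrt_pade_den :: "nat \<Rightarrow> nat \<Rightarrow> real poly" where
  "sqrt_pade_den s t = (\<Sum>j\<le>t. monom (sqrt_coeff s t (real j + 1 / 2)) j)"

lemma poly_sqrt_pade_num: "poly (sqrt_pade_num s t) w = (\<Sum>i\<le>s. sqrt_coeff s t (real i) * w ^ i)"
  by (simp add: sqrt_pade_num_def poly_sum poly_monom)

lemma poly_sqrt_pade_den: "poly (sqrt_pade_den s t) w = (\<Sum>j\<le>t. sqrt_coeff s t (real j + 1 / 2) * w ^ j)"
  by (simp add: sqrt_pade_den_def poly_sum poly_monom)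

lemma sqrt_pade_remainder_eq:
  assumes "w > 0"
  shows "poly (sqrt_pade_num s t) w + sqrt w * poly (sqrt_pade_den s t) w =
    pochhammer (1 / 2 - real s) (s + t + 1) * exp_divdiff (sqrt_nodes s t) (ln w)"
proof -
  let ?T = "pochhammer (1 / 2 - real s) (s + t + 1)"
  have disj: "real ` {..s} \<inter> (\<lambda>j. real j + 1 / 2) ` {..t} = {}" using real_neq_half by auto
  have "?T * exp_divdiff (sqrt_nodes s t) (ln w) = (\<Sum>a\<in>sqrt_nodes s t. sqrt_coeff s t a * exp (a * ln w))"
    unfolding exp_divdiff_def sqrt_coeff_def sum_distrib_left by (intro sum.cong) auto
  also have "\<dots> = (\<Sum>i\<le>s. sqrt_coeff s t (real i) * exp (real i * ln w)) +
      (\<Sum>j\<le>t. sqrt_coeff s t (real j + 1 / 2) * exp ((real j + 1 / 2) * ln w))"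
    by (subst (1) sqrt_nodes_def) (simp add: sum.union_disjoint[OF _ _ disj] sum.reindex inj_on_def)
  also have "(\<Sum>i\<le>s. sqrt_coeff s t (real i) * exp (real i * ln w)) = poly (sqrt_pade_num s t) w"
    unfolding poly_sqrt_pade_num using assms by (simp add: exp_of_nat_mult)
  also have "(\<Sum>j\<le>t. sqrt_coeff s t (real j + 1 / 2) * exp ((real j + 1 / 2) * ln w)) =
      sqrt w * poly (sqrt_pade_den s t) w"
  proof -
    have "exp (ln w / 2) = sqrt w"
      using assms exp_ln[of "sqrt w"] by (simp add: ln_sqrt)
    then have "exp ((real j + 1 / 2) * ln w) = w ^ j * sqrt w" for j
      using assms by (simp add: distrib_right exp_add exp_of_nat_mult)
    then show ?thesis unfolding poly_sqrt_pade_den by (simp add: sum_distrib_left mult_ac)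
  qed
  finally show ?thesis by simp
qed

text \<open>With \<open>N = s + t + 1\<close>, the constant is \<open>24 = 4 * 2 * 3\<close>: the
  Pochhammer symbol over \<open>fact N\<close> is at most \<open>4 ^ N\<close>,
  \<open>\<bar>ln w\<bar>\<close> is at most \<open>2 * \<bar>w - 1\<bar>\<close>, and the
  exponential is at most \<open>3 ^ N\<close> since the nodes are at most \<open>N\<close> and
  \<open>\<bar>ln w\<bar> \<le> 1\<close>.\<close>

lemma sqrt_pade_remainder_le:
  assumes "\<bar>w - 1\<bar> \<le> 1 / 2"
  shows "\<bar>poly (sqrt_pade_num s t) w + sqrt w * poly (sqrt_pade_den s t) w\<bar> \<le> (24 * \<bar>w - 1\<bar>) ^ (s + t + 1)"
proof -
  let ?N = "s + t + 1"
  let ?T = "pochhammer (1 / 2 - real s) ?N"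
  have w: "w > 0" using assms by linarith
  have ln: "\<bar>ln w\<bar> \<le> 2 * \<bar>w - 1\<bar>"
  proof -
    have "\<bar>ln w - (w - 1)\<bar> \<le> 2 * (w - 1)\<^sup>2"
      using abs_ln_one_plus_x_minus_x_bound[OF assms] by simp
    also have "2 * (w - 1)\<^sup>2 \<le> \<bar>w - 1\<bar>"
      using mult_right_mono[OF assms, of "\<bar>w - 1\<bar>"] by (simp add: power2_eq_square abs_mult[symmetric])
    finally show ?thesis using abs_triangle_ineq[of "ln w - (w - 1)" "w - 1"] by simp
  qed
  have "\<bar>?T / fact ?N\<bar> \<le> 2 ^ (s + 1 + ?N)" by (intro abs_pochhammer_div_fact_le) auto
  also have "\<dots> \<le> 2 ^ (2 * ?N)" by (intro power_increasing) auto
  finally have T: "\<bar>?T / fact ?N\<bar> \<le> 4 ^ ?N" unfolding power_mult by simp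
  have "exp (real ?N * \<bar>ln w\<bar>) \<le> exp (real ?N * 1)"
    using ln assms by (intro exp_le_cancel_iff[THEN iffD2] mult_left_mono) auto
  also have "\<dots> = exp 1 ^ ?N" by (metis exp_of_nat_mult)
  also have "\<dots> \<le> 3 ^ ?N" using exp_le by (intro power_mono) auto
  finally have e: "exp (real ?N * \<bar>ln w\<bar>) \<le> 3 ^ ?N" .
  have "\<bar>exp_divdiff (sqrt_nodes s t) (ln w)\<bar> \<le> \<bar>ln w\<bar> ^ ?N / fact ?N * exp (real ?N * \<bar>ln w\<bar>)"
    using card_sqrt_nodes[of s t] by (intro abs_exp_divdiff_le) (auto simp: sqrt_nodes_def)
  then have "\<bar>?T\<bar> * \<bar>exp_divdiff (sqrt_nodes s t) (ln w)\<bar>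
      \<le> \<bar>?T\<bar> * (\<bar>ln w\<bar> ^ ?N / fact ?N * exp (real ?N * \<bar>ln w\<bar>))"
    by (intro mult_left_mono) auto
  also have "\<dots> = \<bar>?T / fact ?N\<bar> * \<bar>ln w\<bar> ^ ?N * exp (real ?N * \<bar>ln w\<bar>)"
    by simp
  also have "\<dots> \<le> 4 ^ ?N * (2 * \<bar>w - 1\<bar>) ^ ?N * 3 ^ ?N"
    using T e ln by (intro mult_mono power_mono) auto
  also have "\<dots> = (24 * \<bar>w - 1\<bar>) ^ ?N"
    unfolding power_mult_distrib[symmetric] by simp
  finally show ?thesis unfolding sqrt_pade_remainder_eq[OF w] abs_mult .
qed

text \<open>The constant is \<open>32 = 2 * 8 * 2\<close>, for the number of terms, the coefficients
  and the powers of \<open>\<bar>w\<bar> \<le> 2\<close>.\<close>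

lemma abs_poly_sqrt_pade_den_le:
  assumes "\<bar>w - 1\<bar> \<le> 1 / 2"
  shows "\<bar>poly (sqrt_pade_den s t) w\<bar> \<le> 32 ^ (s + t + 1)"
proof -
  have "\<bar>poly (sqrt_pade_den s t) w\<bar> \<le> (\<Sum>j\<le>t. \<bar>sqrt_coeff s t (real j + 1 / 2)\<bar> * \<bar>w\<bar> ^ j)"
    unfolding poly_sqrt_pade_den by (rule order_trans[OF sum_abs]) (simp add: abs_mult power_abs)
  also have "\<dots> \<le> (\<Sum>j\<le>t. 8 ^ (s + t + 1) * 2 ^ t)"
  proof (intro sum_mono mult_mono)
    fix j assume j: "j \<in> {..t}"
    then show "\<bar>sqrt_coeff s t (real j + 1 / 2)\<bar> \<le> 8 ^ (s + t + 1)"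
      using abs_sqrt_coeff_half_le by simp
    have "\<bar>w\<bar> \<le> 2" using assms by linarith
    then have "\<bar>w\<bar> ^ j \<le> 2 ^ j" by (intro power_mono) auto
    also have "\<dots> \<le> 2 ^ t" using j by (intro power_increasing) auto
    finally show "\<bar>w\<bar> ^ j \<le> 2 ^ t" .
  qed auto
  also have "\<dots> = real (t + 1) * (8 ^ (s + t + 1) * 2 ^ t)" by simp
  also have "\<dots> \<le> 2 ^ (s + t + 1) * (8 ^ (s + t + 1) * 2 ^ (s + t + 1))"
  proof (intro mult_mono power_increasing)
    have "t + 1 \<le> 2 ^ (t + 1)" using less_exp[of "t + 1"] by simp
    also have "\<dots> \<le> 2 ^ (s + t + 1)" by (intro power_increasing) auto
    finally show "real (t + 1) \<le> 2 ^ (s + t + 1)" by (metis of_nat_le_iff of_nat_numeral of_nat_power)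
  qed auto
  also have "\<dots> = 32 ^ (s + t + 1)" unfolding power_mult_distrib[symmetric] by simp
  finally show ?thesis .
qed

section \<open>Independence of consecutive approximants\<close>

text \<open>If the order of vanishing at \<open>a\<close> were below \<open>N\<close>, the cofactor
  would tend to 0 at \<open>a\<close>, although its value there is nonzero. So the order is at least
  \<open>N\<close>, and the degree leaves room for a constant only.\<close>

lemma poly_eq_const_mult_power:
  fixes p :: "real poly"
  assumes "degree p \<le> N" "p \<noteq> 0" "\<epsilon> > 0"
    and bound: "\<And>w. \<bar>w - a\<bar> \<le> \<epsilon> \<Longrightarrow> \<bar>poly p w\<bar> \<le> K * \<bar>w - a\<bar> ^ N"
  shows "\<exists>c. c \<noteq> 0 \<and> p = smult c ([:- a, 1:] ^ N)"
proof -
  define k where "k = order a p"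
  obtain r where r: "p = [:- a, 1:] ^ k * r" and ndvd: "\<not> [:- a, 1:] dvd r"
    using order_decomp[OF assms(2), of a] unfolding k_def by blast
  have r1: "poly r a \<noteq> 0" using ndvd by (simp add: poly_eq_0_iff_dvd)
  have r0: "r \<noteq> 0" using r1 by auto
  have deg: "degree p = k + degree r"
    unfolding r using r0 by (subst degree_mult_eq) (auto simp: degree_linear_power)
  have "\<not> k < N"
  proof
    assume k: "k < N"
    have le: "\<bar>poly r w\<bar> \<le> K * \<bar>w - a\<bar> ^ (N - k)" if "\<bar>w - a\<bar> \<le> \<epsilon>" "w \<noteq> a" for w
    proof -
      have "\<bar>w - a\<bar> ^ k * \<bar>poly r w\<bar> \<le> K * \<bar>w - a\<bar> ^ N"
        using bound[OF that(1)] unfolding r by (simp add: abs_mult power_abs)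
      also have "\<dots> = \<bar>w - a\<bar> ^ k * (K * \<bar>w - a\<bar> ^ (N - k))"
        using k by (simp flip: power_add)
      finally show ?thesis using that(2) by simp
    qed
    have ev: "eventually (\<lambda>w. \<bar>poly r w\<bar> \<le> K * \<bar>w - a\<bar> ^ (N - k)) (at a)"
      unfolding eventually_at using le assms(3) by (intro exI[of _ \<epsilon>]) (auto simp: dist_real_def)
    have "((\<lambda>w. \<bar>poly r w\<bar>) \<longlongrightarrow> \<bar>poly r a\<bar>) (at a)"
      by (intro tendsto_intros)
    moreover have "((\<lambda>w. K * \<bar>w - a\<bar> ^ (N - k)) \<longlongrightarrow> K * \<bar>a - a\<bar> ^ (N - k)) (at a)"
      by (intro tendsto_intros)
    ultimately have "\<bar>poly r a\<bar> \<le> K * \<bar>a - a\<bar> ^ (N - k)"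
      using ev by (intro tendsto_le[of "at a"]) auto
    then show False using k r1 by (simp add: zero_power)
  qed
  with deg assms(1) have "k = N" "degree r = 0" by auto
  then obtain c where "r = [:c:]" by (metis degree_eq_zeroE)
  with r r0 \<open>k = N\<close> show ?thesis by (intro exI[of _ c]) auto
qed

text \<open>The difference of the two sides is a polynomial of degree exactly \<open>s + t + 1\<close> that vanishes
  to that order at 1, hence it has no other zero.\<close>

lemma sqrt_pade_wronskian_nonzero:
  assumes "w \<noteq> 1"
  shows "poly (sqrt_pade_num (Suc s) t) w * poly (sqrt_pade_den s t) w \<noteq>
         poly (sqrt_pade_num s t) w * poly (sqrt_pade_den (Suc s) t) w"
proof -
  let ?N = "s + t + 1"
  let ?A = "\<lambda>s. sqrt_pade_num s t" and ?B = "\<lambda>s. sqrt_pade_den s t"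
  define W where "W = ?A (Suc s) * ?B s - ?A s * ?B (Suc s)"
  have dA: "degree (?A s) \<le> s" for s
    unfolding sqrt_pade_num_def by (intro degree_sum_le) (auto intro: order_trans[OF degree_monom_le])
  have dB: "degree (?B s) \<le> t" for s
    unfolding sqrt_pade_den_def by (intro degree_sum_le) (auto intro: order_trans[OF degree_monom_le])
  have cA: "coeff (?A s) s = sqrt_coeff s t (real s)" for s
    unfolding sqrt_pade_num_def coeff_sum by simp
  have cB: "coeff (?B s) t = sqrt_coeff s t (real t + 1 / 2)" for s
    unfolding sqrt_pade_den_def coeff_sum by simp
  have "degree (?A s * ?B (Suc s)) \<le> s + t"
    using degree_mult_le[of "?A s" "?B (Suc s)"] dA[of s] dB[of "Suc s"] by linarith
  then have "coeff (?A s * ?B (Suc s)) ?N = 0" by (intro coeff_eq_0) simp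
  \<comment> \<open>The top coefficient of \<open>W\<close> comes from this product alone and is a
    product of two nonzero leading coefficients.\<close>
  moreover have "coeff (?A (Suc s) * ?B s) (Suc s + t) \<noteq> 0"
  proof -
    have "degree (?A (Suc s)) = Suc s"
      using dA[of "Suc s"] cA[of "Suc s"] sqrt_coeff_nonzero by (metis le_antisym le_degree)
    moreover have "degree (?B s) = t"
      using dB[of s] cB[of s] sqrt_coeff_nonzero by (metis le_antisym le_degree)
    ultimately have "coeff (?A (Suc s) * ?B s) (Suc s + t) = coeff (?A (Suc s)) (Suc s) * coeff (?B s) t"
      using coeff_mult_degree_sum[of "?A (Suc s)" "?B s"] by simp
    then show ?thesis unfolding cA cB using sqrt_coeff_nonzero by simp
  qed
  ultimately have "coeff W ?N \<noteq> 0" by (simp add: W_def)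
  then have "W \<noteq> 0" by auto
  have "degree W \<le> ?N"
    unfolding W_def
    using degree_diff_le[of "?A (Suc s) * ?B s" ?N "?A s * ?B (Suc s)"]
      degree_mult_le[of "?A (Suc s)" "?B s"] dA[of "Suc s"] dB[of s]
      \<open>degree (?A s * ?B (Suc s)) \<le> s + t\<close> by linarith
  have "\<bar>poly W x\<bar> \<le> (32 ^ ?N * 24 ^ (?N + 1) + 32 ^ (?N + 1) * 24 ^ ?N) * \<bar>x - 1\<bar> ^ ?N"
    if x: "\<bar>x - 1\<bar> \<le> 1 / 2" for x
  proof -
    let ?R = "\<lambda>s. poly (?A s) x + sqrt x * poly (?B s) x"
    \<comment> \<open>The terms containing \<open>sqrt x\<close> cancel, so numerators may be
      replaced by remainders, which vanish at 1 to order at least \<open>s + t + 1\<close>.\<close>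
    have "poly W x = poly (?B s) x * ?R (Suc s) - poly (?B (Suc s)) x * ?R s"
      by (simp add: W_def algebra_simps)
    then have "\<bar>poly W x\<bar> \<le> \<bar>poly (?B s) x\<bar> * \<bar>?R (Suc s)\<bar> + \<bar>poly (?B (Suc s)) x\<bar> * \<bar>?R s\<bar>"
      by (metis abs_mult abs_triangle_ineq4)
    also have "\<dots> \<le> 32 ^ ?N * (24 * \<bar>x - 1\<bar>) ^ (?N + 1) + 32 ^ (?N + 1) * (24 * \<bar>x - 1\<bar>) ^ ?N"
      using abs_poly_sqrt_pade_den_le[OF x, of s t] abs_poly_sqrt_pade_den_le[OF x, of "Suc s" t]
        sqrt_pade_remainder_le[OF x, of s t] sqrt_pade_remainder_le[OF x, of "Suc s" t]
      by (intro add_mono mult_mono) auto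
    also have "(24 * \<bar>x - 1\<bar>) ^ (?N + 1) \<le> 24 ^ (?N + 1) * \<bar>x - 1\<bar> ^ ?N"
      unfolding power_mult_distrib using x by (intro mult_left_mono power_decreasing) auto
    finally show ?thesis by (simp add: power_mult_distrib algebra_simps)
  qed
  then obtain c where "c \<noteq> 0" "W = smult c ([:- 1, 1:] ^ ?N)"
    using poly_eq_const_mult_power[OF \<open>degree W \<le> ?N\<close> \<open>W \<noteq> 0\<close>, of "1 / 2" 1] by auto
  then have "poly W w \<noteq> 0" using assms by simp
  then show ?thesis by (simp add: W_def)
qed

section \<open>Approximation by rationals with restricted denominators\<close>

text \<open>With \<open>D = v * g\<^sup>2\<close> the argument is \<open>(D + u) / D\<close>, so
  \<open>D ^ s\<close> homogenises the polynomial while the power of 4 clears its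
  coefficients.\<close>

lemma sqrt_pade_num_Ints:
  fixes u v g :: int
  assumes "v > 0" "g > 0"
  shows "4 ^ (s + t + 1) * of_int (v * g\<^sup>2) ^ s * poly (sqrt_pade_num s t) (1 + of_int u / of_int (v * g\<^sup>2)) \<in> \<int>"
proof -
  define D where "D = v * g\<^sup>2"
  have D: "real_of_int D \<noteq> 0" using assms by (simp add: D_def)
  have w: "1 + of_int u / of_int D = of_int (D + u) / real_of_int D" using D by (simp add: field_simps)
  have "4 ^ (s + t + 1) * of_int D ^ s * poly (sqrt_pade_num s t) (1 + of_int u / of_int D) =
     (\<Sum>i\<le>s. (4 ^ (s + t + 1) * sqrt_coeff s t (real i)) * of_int ((D + u) ^ i * D ^ (s - i)))"
    unfolding poly_sqrt_pade_num sum_distrib_left w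
  proof (rule sum.cong[OF refl])
    fix i assume "i \<in> {..s}"
    then have "of_int D ^ s = (of_int D ^ i * of_int D ^ (s - i) :: real)" by (simp flip: power_add)
    then show "4 ^ (s + t + 1) * of_int D ^ s * (sqrt_coeff s t (real i) * (of_int (D + u) / of_int D) ^ i) =
      (4 ^ (s + t + 1) * sqrt_coeff s t (real i)) * of_int ((D + u) ^ i * D ^ (s - i))"
      using D by (simp add: power_divide)
  qed
  also have "\<dots> \<in> \<int>" by (intro Ints_sum Ints_mult[OF sqrt_coeff_int_Ints]) auto
  finally show ?thesis unfolding D_def .
qed

lemma sqrt_pade_den_Ints:
  fixes u v g :: int
  assumes "v > 0" "g > 0"
  shows "4 ^ (s + t + 1) * of_int (v * g\<^sup>2) ^ t * poly (sqrt_pade_den s t) (1 + of_int u / of_int (v * g\<^sup>2)) \<in> \<int>"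
proof -
  define D where "D = v * g\<^sup>2"
  have D: "real_of_int D \<noteq> 0" using assms by (simp add: D_def)
  have w: "1 + of_int u / of_int D = of_int (D + u) / real_of_int D" using D by (simp add: field_simps)
  have "4 ^ (s + t + 1) * of_int D ^ t * poly (sqrt_pade_den s t) (1 + of_int u / of_int D) =
     (\<Sum>j\<le>t. (4 ^ (s + t + 1) * sqrt_coeff s t (real j + 1 / 2)) * of_int ((D + u) ^ j * D ^ (t - j)))"
    unfolding poly_sqrt_pade_den sum_distrib_left w
  proof (rule sum.cong[OF refl])
    fix j assume "j \<in> {..t}"
    then have "of_int D ^ t = (of_int D ^ j * of_int D ^ (t - j) :: real)" by (simp flip: power_add)
    then show "4 ^ (s + t + 1) * of_int D ^ t * (sqrt_coeff s t (real j + 1 / 2) * (of_int (D + u) / of_int D) ^ j) =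
      (4 ^ (s + t + 1) * sqrt_coeff s t (real j + 1 / 2)) * of_int ((D + u) ^ j * D ^ (t - j))"
      using D by (simp add: power_divide)
  qed
  also have "\<dots> \<in> \<int>" by (intro Ints_sum Ints_mult[OF sqrt_coeff_half_Ints]) auto
  finally show ?thesis unfolding D_def .
qed

text \<open>Numerator and denominator are scaled by the same factor, one that makes the numerator
  integral, so their combination with the square root stays controlled by the remainder.\<close>

definition approx_num :: "int \<Rightarrow> int \<Rightarrow> int \<Rightarrow> nat \<Rightarrow> nat \<Rightarrow> real" where
  "approx_num u v g s t = 4 ^ (s + t + 1) * of_int (v * g\<^sup>2) ^ s * poly (sqrt_pade_num s t) (1 + of_int u / of_int (v * g\<^sup>2))"

definition approx_den :: "int \<Rightarrow> int \<Rightarrow> int \<Rightarrow> nat \<Rightarrow> nat \<Rightarrow> real" where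
  "approx_den u v g s t = 4 ^ (s + t + 1) * of_int (v * g\<^sup>2) ^ s * poly (sqrt_pade_den s t) (1 + of_int u / of_int (v * g\<^sup>2))"

lemma approx_num_Ints: "v > 0 \<Longrightarrow> g > 0 \<Longrightarrow> approx_num u v g s t \<in> \<int>"
  unfolding approx_num_def by (rule sqrt_pade_num_Ints)

text \<open>The denominator polynomial has degree only \<open>t\<close>, hence the surplus power of \<open>g\<close>.\<close>

lemma approx_den_dvd:
  assumes "v > 0" "g > 0" "t \<le> s"
  shows "\<exists>q :: int. approx_den u v g s t = of_int (g ^ (2 * (s - t)) * q)"
proof -
  have "of_int (v * g\<^sup>2) ^ s = (of_int (v * g\<^sup>2) ^ (s - t) * of_int (v * g\<^sup>2) ^ t :: real)"
    using assms(3) by (simp flip: power_add)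
  then have "approx_den u v g s t = of_int (g ^ (2 * (s - t))) * (of_int (v ^ (s - t)) *
     (4 ^ (s + t + 1) * of_int (v * g\<^sup>2) ^ t * poly (sqrt_pade_den s t) (1 + of_int u / of_int (v * g\<^sup>2))))"
    unfolding approx_den_def by (simp add: power_mult_distrib power_mult)
  moreover have "of_int (v ^ (s - t)) *
     (4 ^ (s + t + 1) * of_int (v * g\<^sup>2) ^ t * poly (sqrt_pade_den s t) (1 + of_int u / of_int (v * g\<^sup>2))) \<in> \<int>"
    by (intro Ints_mult[OF _ sqrt_pade_den_Ints[OF assms(1,2)]] Ints_of_int)
  ultimately show ?thesis by (metis Ints_cases of_int_mult)
qed

text \<open>The condition \<open>g \<ge> 2 * U\<close> puts the argument within \<open>1 / 2\<close>
  of 1. Its distance from 1 is at most \<open>U / g\<^sup>2\<close>, so the remainder contributes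
  \<open>g\<close> to the power \<open>- 2 * (s + t + 1)\<close>, of which the scaling gives back
  \<open>2 * s\<close>.\<close>

lemma approx_bounds:
  fixes U V :: real
  assumes "v > 0" "g > 0" "\<bar>of_int u\<bar> \<le> U" "of_int v \<le> V" "U \<ge> 1" "V \<ge> 1" "of_int g \<ge> 2 * U"
  shows "\<bar>approx_num u v g s t + sqrt (1 + of_int u / of_int (v * g\<^sup>2)) * approx_den u v g s t\<bar>
          \<le> (128 * U * V) ^ (s + t + 1) / of_int g ^ (2 * t + 2)"
    and "\<bar>approx_den u v g s t\<bar> \<le> (128 * U * V) ^ (s + t + 1) * of_int g ^ (2 * s)"
proof -
  let ?N = "s + t + 1"
  define z :: real where "z = of_int u / of_int (v * g\<^sup>2)"
  have v1: "real_of_int v \<ge> 1" using assms(1) by linarith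
  have g1: "real_of_int g \<ge> 1" using assms(2) by linarith
  have "\<bar>z\<bar> = \<bar>of_int u\<bar> / (of_int v * of_int g ^ 2)"
    unfolding z_def using assms(1,2) by (simp add: abs_mult)
  also have "\<dots> \<le> U / (1 * of_int g ^ 2)"
    using assms v1 g1 by (intro frac_le mult_right_mono) auto
  finally have z: "\<bar>z\<bar> \<le> U / of_int g ^ 2" by simp
  have "2 * U * 1 \<le> of_int g * of_int g" using assms g1 by (intro mult_mono) auto
  then have "U / of_int g ^ 2 \<le> 1 / 2" using g1 by (simp add: field_simps power2_eq_square)
  with z have z2: "\<bar>z\<bar> \<le> 1 / 2" by linarith
  have D: "real_of_int (v * g\<^sup>2) ^ s \<le> V ^ ?N * of_int g ^ (2 * s)"
  proof -
    have "real_of_int (v * g\<^sup>2) ^ s = of_int v ^ s * of_int g ^ (2 * s)"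
      by (simp add: power_mult_distrib power_mult)
    also have "\<dots> \<le> V ^ ?N * of_int g ^ (2 * s)"
    proof (rule mult_right_mono)
      have "real_of_int v ^ s \<le> V ^ s" using assms v1 by (intro power_mono) auto
      also have "\<dots> \<le> V ^ ?N" using assms by (intro power_increasing) auto
      finally show "real_of_int v ^ s \<le> V ^ ?N" .
    qed (use g1 in auto)
    finally show ?thesis .
  qed
  have D0: "real_of_int (v * g\<^sup>2) ^ s \<ge> 0" using assms by simp
  let ?A = "poly (sqrt_pade_num s t) (1 + z)" and ?B = "poly (sqrt_pade_den s t) (1 + z)"
  have "\<bar>approx_num u v g s t + sqrt (1 + of_int u / of_int (v * g\<^sup>2)) * approx_den u v g s t\<bar> =
     \<bar>4 ^ ?N * of_int (v * g\<^sup>2) ^ s * (?A + sqrt (1 + z) * ?B)\<bar>"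
    unfolding approx_num_def approx_den_def z_def by (simp only: algebra_simps)
  also have "\<dots> = 4 ^ ?N * of_int (v * g\<^sup>2) ^ s * \<bar>?A + sqrt (1 + z) * ?B\<bar>"
    using D0 by (simp add: abs_mult)
  also have "\<dots> \<le> 4 ^ ?N * (V ^ ?N * of_int g ^ (2 * s)) * (24 * (U / of_int g ^ 2)) ^ ?N"
  proof (intro mult_mono D)
    have "\<bar>?A + sqrt (1 + z) * ?B\<bar> \<le> (24 * \<bar>z\<bar>) ^ ?N"
      using sqrt_pade_remainder_le[of "1 + z" s t] z2 by simp
    also have "\<dots> \<le> (24 * (U / of_int g ^ 2)) ^ ?N" using z by (intro power_mono) auto
    finally show "\<bar>?A + sqrt (1 + z) * ?B\<bar> \<le> (24 * (U / of_int g ^ 2)) ^ ?N" .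
  qed (use assms D0 in auto)
  also have "\<dots> = (96 * U * V) ^ ?N * (of_int g ^ (2 * s) / of_int g ^ (2 * ?N))"
  proof -
    have "(96::real) ^ ?N = 4 ^ ?N * 24 ^ ?N" unfolding power_mult_distrib[symmetric] by simp
    then show ?thesis
      by (simp only: power_mult_distrib power_divide power_mult times_divide_eq_right mult_ac)
  qed
  also have "of_int g ^ (2 * s) / of_int g ^ (2 * ?N) = 1 / real_of_int g ^ (2 * t + 2)"
  proof -
    have "2 * ?N = 2 * s + (2 * t + 2)" by simp
    then show ?thesis using assms(2) by (simp only: power_add) simp
  qed
  \<comment> \<open>The base \<open>96 = 4 * 24\<close> is enlarged to \<open>128 = 4 * 32\<close>,
    the base in the second bound.\<close>
  also have "(96 * U * V) ^ ?N * (1 / real_of_int g ^ (2 * t + 2)) \<le> (128 * U * V) ^ ?N * (1 / real_of_int g ^ (2 * t + 2))"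
    using assms by (intro mult_right_mono power_mono) auto
  finally show "\<bar>approx_num u v g s t + sqrt (1 + of_int u / of_int (v * g\<^sup>2)) * approx_den u v g s t\<bar>
          \<le> (128 * U * V) ^ (s + t + 1) / of_int g ^ (2 * t + 2)" by simp
  have "\<bar>approx_den u v g s t\<bar> = 4 ^ ?N * of_int (v * g\<^sup>2) ^ s * \<bar>?B\<bar>"
    unfolding approx_den_def z_def using D0 by (simp add: abs_mult)
  also have "\<dots> \<le> 4 ^ ?N * (V ^ ?N * of_int g ^ (2 * s)) * 32 ^ ?N"
    using abs_poly_sqrt_pade_den_le[of "1 + z" s t] z2 assms D0 by (intro mult_mono D) auto
  also have "\<dots> = (128 * 1 * V) ^ ?N * of_int g ^ (2 * s)"
  proof -
    have "(128::real) ^ ?N = 4 ^ ?N * 32 ^ ?N" unfolding power_mult_distrib[symmetric] by simp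
    then show ?thesis by (simp only: power_mult_distrib mult_ac power_one mult_1_right mult_1_left)
  qed
  also have "\<dots> \<le> (128 * U * V) ^ ?N * of_int g ^ (2 * s)"
    using assms by (intro mult_right_mono power_mono mult_left_mono) auto
  finally show "\<bar>approx_den u v g s t\<bar> \<le> (128 * U * V) ^ (s + t + 1) * of_int g ^ (2 * s)" .
qed

text \<open>The scaling factors are nonzero and \<open>u \<noteq> 0\<close> keeps the argument away
  from 1. The two linear forms for \<open>s\<close> and \<open>Suc s\<close> therefore cannot vanish
  at a common nonzero point.\<close>

lemma approx_independent:
  assumes "v > 0" "g > 0" "u \<noteq> 0"
  shows "approx_num u v g (Suc s) t * approx_den u v g s t \<noteq> approx_num u v g s t * approx_den u v g (Suc s) t"
proof -
  let ?w = "1 + of_int u / of_int (v * g\<^sup>2) :: real"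
  have "?w \<noteq> 1" using assms by simp
  from sqrt_pade_wronskian_nonzero[OF this, of s t] show ?thesis
    unfolding approx_num_def approx_den_def using assms by simp
qed

section \<open>The lower bound for restricted denominators\<close>

lemma eventually_power2_ge: "\<exists>M. \<forall>m\<ge>M. (x::real) \<le> 2 ^ m"
proof -
  obtain M where "x < 2 ^ M" using real_arch_pow[of 2 x] by auto
  moreover have "(2::real) ^ M \<le> 2 ^ m" if "m \<ge> M" for m using that by (intro power_increasing) auto
  ultimately show ?thesis by (meson order.strict_implies_order order.trans)
qed

lemma exists_power_between:
  fixes g x :: real
  assumes "g > 1" "x > 1"
  shows "\<exists>t. x \<le> g ^ Suc t \<and> g ^ t \<le> x"
proof -
  obtain T where T: "x < g ^ T" using real_arch_pow[OF assms(1)] by blast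
  define k where "k = (LEAST k. x < g ^ k)"
  have k: "x < g ^ k" unfolding k_def using T by (rule LeastI)
  then have "k \<noteq> 0" using assms by (cases "k = 0") auto
  then obtain t where t: "k = Suc t" using not0_implies_Suc by blast
  have "\<not> x < g ^ t" using not_less_Least[of t "\<lambda>k. x < g ^ k"] t unfolding k_def by simp
  then show ?thesis using k t by (intro exI[of _ t]) auto
qed

text \<open>The constants \<open>\<eta>\<close> and \<open>N\<close> depend on \<open>U\<close> and
  \<open>V\<close> only. The unbounded \<open>c\<close> and \<open>h\<close> enter through the
  threshold \<open>M\<close>, which makes the bound uniform over all convergents of one
  number.\<close>

lemma sqrt_restricted_approximation:
  fixes U V :: real
  assumes "U \<ge> 1" "V \<ge> 1"
  shows "\<exists>\<eta>>0. \<exists>N::real. \<forall>(g::int) (h::int) (c::int) (u::int) (v::int).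
     of_int g \<ge> N \<and> g > 0 \<and> h > 0 \<and> c > 0 \<and> u \<noteq> 0 \<and> \<bar>of_int u\<bar> \<le> U \<and> v > 0 \<and> of_int v \<le> V \<longrightarrow>
     (\<exists>M. \<forall>m\<ge>M. \<forall>n::int.
        \<bar>of_int (c * g) / of_int h * sqrt (1 + of_int u / of_int (v * g\<^sup>2)) - of_int n / of_int g ^ m\<bar>
          \<ge> 1 / (\<eta> * of_int g) ^ m)"
proof -
  \<comment> \<open>The exponent 5 comes from \<open>s + t + 1 \<le> 5 * m\<close>; the factor 2 in
    \<open>C2\<close> absorbs \<open>c\<close>, and the one in \<open>\<eta>\<close> absorbs
    \<open>h\<close> and a fixed power of \<open>g\<close>. \<open>N\<close> ensures both
    \<open>g \<ge> C2\<close> and \<open>g \<ge> 2 * U\<close>.\<close>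
  define C1 where "C1 = (128 * U * V) ^ 5"
  define C2 where "C2 = 2 * C1"
  define \<eta> where "\<eta> = 2 * C1 * C2 ^ 2"
  define N where "N = C2 + 2 * U"
  have UV: "U * V \<ge> 1" using mult_mono[OF assms] assms by simp
  then have C: "128 * U * V \<ge> 1" by simp
  then have C1: "C1 \<ge> 1" unfolding C1_def by (rule one_le_power)
  have C2: "C2 \<ge> 2" using C1 by (simp add: C2_def)
  have \<eta>: "\<eta> > 0" using C1 C2 by (simp add: \<eta>_def)
  have main: "\<exists>M. \<forall>m\<ge>M. \<forall>n::int.
        \<bar>of_int (c * g) / of_int h * sqrt (1 + of_int u / of_int (v * g\<^sup>2)) - of_int n / of_int g ^ m\<bar>
          \<ge> 1 / (\<eta> * of_int g) ^ m"
    if gN: "of_int g \<ge> N" and g: "g > 0" and h: "h > 0" and c: "c > 0" and u: "u \<noteq> 0"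
      and uU: "\<bar>of_int u\<bar> \<le> U" and v: "v > 0" and vV: "of_int v \<le> V"
    for g h c u v :: int
  proof -
    define \<theta> where "\<theta> = of_int (c * g) / of_int h * sqrt (1 + of_int u / of_int (v * g\<^sup>2))"
    have gC2: "of_int g \<ge> C2" and g2U: "of_int g \<ge> 2 * U" using gN C2 assms by (auto simp: N_def)
    have g1: "real_of_int g > 1" using gC2 C2 by linarith
    obtain M1 where M1: "\<And>m. m \<ge> M1 \<Longrightarrow> 4 * of_int c \<le> (2::real) ^ m"
      using eventually_power2_ge by blast
    obtain M2 where M2: "\<And>m. m \<ge> M2 \<Longrightarrow> 2 * of_int h * of_int g ^ 5 \<le> (2::real) ^ m"
      using eventually_power2_ge by blast
    have "1 / (\<eta> * of_int g) ^ m \<le> \<bar>\<theta> - of_int n / of_int g ^ m\<bar>" if m: "m \<ge> max 2 (max M1 M2)" for m n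
    proof -
      have m1: "m \<ge> 2" and mM1: "4 * of_int c \<le> (2::real) ^ m" and mM2: "2 * of_int h * of_int g ^ 5 \<le> (2::real) ^ m"
        using m M1 M2 by auto
      have "C2 ^ m > 1" using C2 m1 by (intro one_less_power) auto
      \<comment> \<open>With \<open>t = Suc t0\<close>, \<open>g ^ t\<close> is large enough to beat
        the remainder, yet exceeds \<open>C2 ^ m\<close> by at most one factor \<open>g\<close>,
        which limits the size of the denominator.\<close>
      then obtain t0 where t0: "C2 ^ m \<le> of_int g ^ Suc t0" "of_int g ^ t0 \<le> C2 ^ m"
        using exists_power_between[OF g1] by blast
      define t where "t = Suc t0"
      have "t0 \<le> m"
      proof (rule ccontr)
        assume "\<not> t0 \<le> m"
        then have "real_of_int g ^ t0 > of_int g ^ m" using g1 by (intro power_strict_increasing) auto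
        moreover have "of_int g ^ m \<ge> C2 ^ m" using gC2 C2 by (intro power_mono) auto
        ultimately show False using t0 by linarith
      qed
      \<comment> \<open>This makes \<open>2 * (s0 - t)\<close> equal to \<open>m\<close> or
        \<open>m - 1\<close>; the divisibility below therefore uses the exponent
        \<open>m - 1\<close>.\<close>
      define s0 where "s0 = t + m div 2"
      let ?p = "\<lambda>s. approx_num u v g s t" and ?q = "\<lambda>s. approx_den u v g s t"
      \<comment> \<open>The exponent is \<open>m + 1\<close> because \<open>\<theta>\<close> already
        contains a factor \<open>g\<close>: \<open>h * \<theta> * g ^ m\<close> is
        \<open>c * g ^ (m + 1)\<close> times the square root.\<close>
      define \<Delta> where "\<Delta> = (\<lambda>s. ?p s * of_int (c * g ^ (m + 1)) + of_int (n * h) * ?q s)"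
      have "\<exists>s. (s = s0 \<or> s = Suc s0) \<and> \<Delta> s \<noteq> 0"
      proof (rule ccontr)
        assume "\<not> ?thesis"
        then have "\<Delta> s0 = 0" "\<Delta> (Suc s0) = 0" by auto
        then have "?p s0 * of_int (c * g ^ (m + 1)) = - of_int (n * h) * ?q s0"
          "?p (Suc s0) * of_int (c * g ^ (m + 1)) = - of_int (n * h) * ?q (Suc s0)"
          by (auto simp: \<Delta>_def add_eq_0_iff)
        then have "(?p (Suc s0) * of_int (c * g ^ (m + 1))) * ?q s0 = (?p s0 * of_int (c * g ^ (m + 1))) * ?q (Suc s0)"
          by (simp only: mult_ac)
        moreover have "real_of_int (c * g ^ (m + 1)) \<noteq> 0" using c g by simp
        ultimately show False using approx_independent[OF v g u, of s0 t] by simp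
      qed
      then obtain s where s: "s = s0 \<or> s = Suc s0" and nz: "\<Delta> s \<noteq> 0" by blast
      have ts: "t \<le> s" "m - 1 \<le> 2 * (s - t)" using s by (auto simp: s0_def)
      have s2: "2 * s \<le> m + 2 * t + 2" using s by (auto simp: s0_def)
      have N5: "s + t + 1 \<le> 5 * m" using s \<open>t0 \<le> m\<close> m1 by (auto simp: s0_def t_def)
      define K where "K = C1 ^ m"
      have K1: "K \<ge> 1" unfolding K_def using C1 by (rule one_le_power)
      have CK: "(128 * U * V) ^ (s + t + 1) \<le> K"
        unfolding K_def C1_def power_mult[symmetric] using C N5 by (intro power_increasing)
      have C2K: "C2 ^ m = 2 ^ m * K" by (simp add: C2_def K_def power_mult_distrib)
      have split: "g ^ (m + 1) = g ^ (m - 1) * g ^ 2"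
        using m1 by (simp flip: power_add)
      define G where "G = real_of_int g ^ (m - 1)"
      have G: "G > 0" using g by (simp add: G_def)
      define R where "R = ?p s + sqrt (1 + of_int u / of_int (v * g\<^sup>2)) * ?q s"
      have R: "\<bar>R\<bar> \<le> K / of_int g ^ (2 * t + 2)"
      proof -
        have "\<bar>R\<bar> \<le> (128 * U * V) ^ (s + t + 1) / of_int g ^ (2 * t + 2)"
          unfolding R_def by (rule approx_bounds(1)[OF v g uU vV assms g2U])
        also have "\<dots> \<le> K / of_int g ^ (2 * t + 2)" using CK g by (intro divide_right_mono) auto
        finally show ?thesis .
      qed
      have q: "\<bar>?q s\<bar> \<le> G * (K * (C2 ^ m) ^ 2 * of_int g ^ 5)"
      proof -
        have "\<bar>?q s\<bar> \<le> (128 * U * V) ^ (s + t + 1) * of_int g ^ (2 * s)"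
          by (rule approx_bounds(2)[OF v g uU vV assms g2U])
        \<comment> \<open>The 5 collects the 1 missing from \<open>m - 1\<close>, the 2 from
          \<open>t = Suc t0\<close> and the 2 from \<open>s \<le> Suc s0\<close>.\<close>
        also have "\<dots> \<le> K * of_int g ^ (m - 1 + 2 * t0 + 5)"
          using CK s2 g1 K1 m1 by (intro mult_mono power_increasing) (auto simp: t_def)
        also have "\<dots> = G * (K * (of_int g ^ t0) ^ 2 * of_int g ^ 5)"
          by (simp only: G_def power_add power_even_eq) (simp only: mult_ac)
        also have "\<dots> \<le> G * (K * (C2 ^ m) ^ 2 * of_int g ^ 5)"
          using t0(2) g G K1 by (intro mult_left_mono mult_right_mono power_mono) auto
        finally show ?thesis .
      qed
      \<comment> \<open>Both summands are integers divisible by \<open>g ^ (m - 1)\<close>, and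
        their sum is nonzero.\<close>
      have "\<bar>\<Delta> s\<bar> \<ge> G"
      proof -
        obtain P where P: "?p s = of_int P" using approx_num_Ints[OF v g] Ints_cases by blast
        obtain Q where Q: "?q s = of_int (g ^ (2 * (s - t)) * Q)" using approx_den_dvd[OF v g ts(1)] by blast
        define Z where "Z = P * (c * g ^ (m + 1)) + n * h * (g ^ (2 * (s - t)) * Q)"
        have Z: "\<Delta> s = of_int Z" by (simp add: \<Delta>_def P Q Z_def)
        have "g ^ (m - 1) dvd g ^ (2 * (s - t))" using ts(2) by (rule le_imp_power_dvd)
        moreover have "g ^ (m - 1) dvd g ^ (m + 1)" by (rule le_imp_power_dvd) simp
        ultimately have "g ^ (m - 1) dvd Z"
          unfolding Z_def by (intro dvd_add dvd_mult dvd_mult2)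
        moreover have "Z \<noteq> 0" using nz Z by auto
        ultimately have "\<bar>g ^ (m - 1)\<bar> \<le> \<bar>Z\<bar>" by (rule dvd_imp_le_int[rotated])
        then have "real_of_int \<bar>g ^ (m - 1)\<bar> \<le> real_of_int \<bar>Z\<bar>" by (rule of_int_le_iff[THEN iffD2])
        then show ?thesis using g by (simp add: Z G_def)
      qed
      \<comment> \<open>This splits the integer into the part governed by the remainder and the part
        measuring the distance of \<open>\<theta>\<close> from \<open>n / g ^ m\<close>.\<close>
      moreover have "\<Delta> s = of_int c * of_int g ^ (m + 1) * R - of_int h * ?q s * (\<theta> * of_int g ^ m - of_int n)"
        unfolding \<Delta>_def R_def \<theta>_def using h by (simp add: field_simps)
      ultimately have "G \<le> \<bar>of_int c * of_int g ^ (m + 1) * R\<bar> + \<bar>of_int h * ?q s * (\<theta> * of_int g ^ m - of_int n)\<bar>"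
        using abs_triangle_ineq4 order_trans by metis
      moreover have "\<bar>of_int c * of_int g ^ (m + 1) * R\<bar> \<le> G / 4"
      proof -
        have "of_int c * K * 4 \<le> 2 ^ m * K" using mM1 K1 by simp
        also have "\<dots> \<le> of_int g ^ t" using t0(1) C2K by (simp add: t_def)
        also have "\<dots> \<le> of_int g ^ (2 * t)" using g1 by (intro power_increasing) auto
        finally have le: "of_int c * K / of_int g ^ (2 * t) \<le> 1 / 4" using g by (simp add: divide_simps)
        have "\<bar>of_int c * of_int g ^ (m + 1) * R\<bar> = of_int c * (G * of_int g ^ 2) * \<bar>R\<bar>"
          using c g split by (simp add: abs_mult G_def flip: of_int_power of_int_mult)
        also have "\<dots> \<le> of_int c * (G * of_int g ^ 2) * (K / of_int g ^ (2 * t + 2))"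
          using R c G by (intro mult_left_mono) auto
        also have "\<dots> = G * (of_int c * K / of_int g ^ (2 * t))"
          using g by (simp add: power_add power2_eq_square)
        also have "\<dots> \<le> G * (1 / 4)" using le G by (intro mult_left_mono) auto
        finally show ?thesis by simp
      qed
      \<comment> \<open>The remainder part is at most \<open>G / 4\<close>, so the approximation
        error has to account for the rest.\<close>
      ultimately have "G / 2 \<le> of_int h * \<bar>?q s\<bar> * \<bar>\<theta> * of_int g ^ m - of_int n\<bar>"
        using G h by (simp add: abs_mult)
      also have "\<dots> \<le> of_int h * (G * (K * (C2 ^ m) ^ 2 * of_int g ^ 5)) * \<bar>\<theta> * of_int g ^ m - of_int n\<bar>"
        using q h by (intro mult_right_mono mult_left_mono) auto
      also have "\<dots> = G / 2 * ((2 * of_int h * of_int g ^ 5) * (K * (C2 ^ m) ^ 2 * \<bar>\<theta> * of_int g ^ m - of_int n\<bar>))"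
        by simp
      finally have "1 \<le> (2 * of_int h * of_int g ^ 5) * (K * (C2 ^ m) ^ 2 * \<bar>\<theta> * of_int g ^ m - of_int n\<bar>)"
        using G by (simp add: mult_le_cancel_left1)
      also have "\<dots> \<le> 2 ^ m * (K * (C2 ^ m) ^ 2 * \<bar>\<theta> * of_int g ^ m - of_int n\<bar>)"
        using mM2 K1 by (intro mult_right_mono) auto
      \<comment> \<open>Here \<open>2 ^ m * C1 ^ m * C2 ^ (2 * m)\<close> is collected, which
        explains the shape of \<open>\<eta>\<close>.\<close>
      also have "\<dots> = \<eta> ^ m * \<bar>\<theta> * of_int g ^ m - of_int n\<bar>"
        by (simp add: \<eta>_def K_def power_mult_distrib power2_eq_square)
      also have "\<bar>\<theta> * of_int g ^ m - of_int n\<bar> = of_int g ^ m * \<bar>\<theta> - of_int n / of_int g ^ m\<bar>"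
      proof -
        have "\<theta> * of_int g ^ m - of_int n = of_int g ^ m * (\<theta> - of_int n / of_int g ^ m)"
          using g by (simp add: right_diff_distrib)
        then show ?thesis using g by (simp add: abs_mult)
      qed
      finally show ?thesis using \<eta> g by (simp add: divide_simps power_mult_distrib mult_ac)
    qed
    then show ?thesis unfolding \<theta>_def by blast
  qed
  then show ?thesis using \<eta> by blast
qed

section \<open>Convergents of an irrational number\<close>

context
  fixes x :: real
  assumes irrational: "x \<notin> \<rat>"
begin

lemma cf_rem_irrational: "cf_rem x k \<notin> \<rat>"
proof (induction k)
  case 0
  then show ?case using irrational by simp
next
  case (Suc k)
  show ?case
  proof
    assume "cf_rem x (Suc k) \<in> \<rat>"
    then have "1 / cf_rem x (Suc k) + of_int \<lfloor>cf_rem x k\<rfloor> \<in> \<rat>" by (intro Rats_add Rats_divide) auto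
    then show False using Suc by simp
  qed
qed

lemma cf_rem_frac: "0 < cf_rem x k - of_int (cf_a x k)" "cf_rem x k - of_int (cf_a x k) < 1"
proof -
  have "cf_rem x k \<noteq> of_int (cf_a x k)" using cf_rem_irrational[of k] by (metis Rats_of_int)
  moreover have "of_int (cf_a x k) \<le> cf_rem x k" by (simp add: cf_a_def)
  ultimately show "0 < cf_rem x k - of_int (cf_a x k)" by simp
  show "cf_rem x k - of_int (cf_a x k) < 1" unfolding cf_a_def by linarith
qed

lemma cf_rem_Suc_gt_1: "cf_rem x (Suc k) > 1"
  using cf_rem_frac[of k] by (simp add: cf_a_def)

lemma cf_a_Suc_ge_1: "cf_a x (Suc k) \<ge> 1"
  using cf_rem_Suc_gt_1[of k] unfolding cf_a_def by linarith

lemma cf_q_pos: "cf_q x k > 0 \<and> cf_q x k \<le> cf_q x (Suc k)"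
proof (induction k)
  case 0
  then show ?case using cf_a_Suc_ge_1[of 0] by simp
next
  case (Suc k)
  then have "1 * cf_q x (Suc k) \<le> cf_a x (k + 2) * cf_q x (Suc k)"
    using cf_a_Suc_ge_1[of "Suc k"] by (intro mult_right_mono) auto
  then have "cf_q x (Suc k) \<le> cf_a x (k + 2) * cf_q x (Suc k) + cf_q x k" using Suc by linarith
  then show ?case using Suc by simp
qed

text \<open>The errors \<open>q * x - p\<close> obey the same recurrence as \<open>p\<close> and
  \<open>q\<close>, and each complete quotient is the reciprocal of the preceding fractional part,
  so consecutive errors have ratio minus the reciprocal of a complete quotient.\<close>

lemma cf_error_step:
  "cf_rem x (k + 2) * (of_int (cf_q x (Suc k)) * x - of_int (cf_p x (Suc k))) =
     - (of_int (cf_q x k) * x - of_int (cf_p x k))"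
proof (induction k)
  case 0
  define r where "r = cf_rem x 1"
  have r: "r * (x - of_int (cf_a x 0)) = 1" using cf_rem_frac[of 0] by (simp add: r_def cf_a_def)
  have r2: "cf_rem x (Suc (Suc 0)) * (r - of_int (cf_a x 1)) = 1"
    using cf_rem_frac[of 1] by (simp add: r_def cf_a_def)
  have "of_int (cf_q x (Suc 0)) * x - of_int (cf_p x (Suc 0)) = - (r - of_int (cf_a x 1)) * (x - of_int (cf_a x 0))"
    using r by (simp add: algebra_simps)
  then have "cf_rem x (Suc (Suc 0)) * (of_int (cf_q x (Suc 0)) * x - of_int (cf_p x (Suc 0))) =
      - (cf_rem x (Suc (Suc 0)) * (r - of_int (cf_a x 1))) * (x - of_int (cf_a x 0))"
    by (simp only: mult_minus_left mult_minus_right mult.assoc)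
  then show ?case unfolding r2 by (simp add: numeral_2_eq_2 del: cf_rem.simps)
next
  case (Suc k)
  define e where "e = (\<lambda>k. of_int (cf_q x k) * x - of_int (cf_p x k))"
  have r: "cf_rem x (Suc (Suc (Suc k))) * (cf_rem x (k + 2) - of_int (cf_a x (k + 2))) = 1"
    using cf_rem_frac[of "k + 2"] by (simp add: cf_a_def)
  have "e (Suc (Suc k)) = of_int (cf_a x (k + 2)) * e (Suc k) + e k"
    by (simp add: e_def algebra_simps)
  also have "e k = - cf_rem x (k + 2) * e (Suc k)" using Suc by (simp add: e_def)
  finally have "e (Suc (Suc k)) = - (cf_rem x (k + 2) - of_int (cf_a x (k + 2))) * e (Suc k)"
    by (simp add: algebra_simps)
  then have "cf_rem x (Suc (Suc (Suc k))) * e (Suc (Suc k)) =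
     - (cf_rem x (Suc (Suc (Suc k))) * (cf_rem x (k + 2) - of_int (cf_a x (k + 2)))) * e (Suc k)"
    by (simp only: mult_minus_left mult_minus_right mult.assoc)
  then show ?case unfolding r e_def by simp
qed

lemma cf_det: "cf_p x (Suc k) * cf_q x k - cf_p x k * cf_q x (Suc k) = (- 1) ^ k"
proof (induction k)
  case (Suc k)
  then show ?case by (simp add: algebra_simps)
qed simp

text \<open>Eliminating the next error from the determinant identity shows that the error times
  \<open>q_(k+1) + q_k / r\<close> is a sign, with \<open>r > 1\<close> the complete quotient of
  index \<open>k + 2\<close>; that factor is at least \<open>q_k\<close>.\<close>

lemma cf_error_le: "\<bar>of_int (cf_q x k) * x - of_int (cf_p x k)\<bar> \<le> 1 / of_int (cf_q x k)"
proof -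
  define e where "e = (\<lambda>k. of_int (cf_q x k) * x - of_int (cf_p x k))"
  define r where "r = cf_rem x (k + 2)"
  have r: "r > 1" using cf_rem_Suc_gt_1[of "Suc k"] by (simp add: r_def)
  have ek: "e (Suc k) = - e k / r"
    using cf_error_step[of k] r unfolding e_def r_def[symmetric] by (simp add: field_simps)
  have q: "real_of_int (cf_q x k) > 0" "real_of_int (cf_q x k) \<le> of_int (cf_q x (Suc k))"
    using cf_q_pos[of k] by auto
  have "of_int (cf_q x (Suc k)) * e k - of_int (cf_q x k) * e (Suc k) =
     of_int (cf_p x (Suc k) * cf_q x k - cf_p x k * cf_q x (Suc k))"
    by (simp add: e_def algebra_simps)
  then have "e k * (of_int (cf_q x (Suc k)) + of_int (cf_q x k) / r) = (- 1) ^ k"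
    unfolding cf_det ek by (simp add: algebra_simps)
  then have "\<bar>e k\<bar> * \<bar>of_int (cf_q x (Suc k)) + of_int (cf_q x k) / r\<bar> = 1"
    by (metis abs_mult abs_power_minus abs_one power_one)
  moreover have "of_int (cf_q x k) \<le> \<bar>of_int (cf_q x (Suc k)) + of_int (cf_q x k) / r\<bar>"
    using q r by (smt (verit) divide_pos_pos)
  ultimately have "\<bar>e k\<bar> * of_int (cf_q x k) \<le> 1"
    by (metis abs_ge_zero mult_left_mono)
  then show ?thesis using q(1) by (simp add: e_def field_simps)
qed

text \<open>A convergent is given only as an equality of fractions. Coprimality makes
  \<open>b\<close> divide the continuant \<open>cf_q x k\<close>, so the error bound passes to
  \<open>b\<close>.\<close>

lemma cf_convergent_error_le:
  assumes "is_cf_convergent x a b" "b > 0" "coprime a b"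
  shows "\<bar>x - of_int a / of_int b\<bar> \<le> 1 / of_int b ^ 2"
proof -
  obtain k where k: "real_of_int a / of_int b = of_int (cf_p x k) / of_int (cf_q x k)"
    using assms(1) by (auto simp: is_cf_convergent_def)
  have q: "cf_q x k > 0" using cf_q_pos by blast
  have "real_of_int (a * cf_q x k) = of_int (cf_p x k * b)"
    using k q assms(2) by (simp add: field_simps)
  then have "a * cf_q x k = cf_p x k * b" by (simp only: of_int_eq_iff)
  then have "b dvd a * cf_q x k" by simp
  then have "b dvd cf_q x k" using assms(3) by (simp add: coprime_dvd_mult_right_iff coprime_commute)
  then have "b \<le> cf_q x k" using q by (rule zdvd_imp_le)
  have "\<bar>x - of_int a / of_int b\<bar> = \<bar>of_int (cf_q x k) * x - of_int (cf_p x k)\<bar> / of_int (cf_q x k)"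
  proof -
    have "x - of_int (cf_p x k) / of_int (cf_q x k) = (of_int (cf_q x k) * x - of_int (cf_p x k)) / of_int (cf_q x k)"
      using q by (simp add: field_simps)
    then show ?thesis unfolding k using q by (simp add: abs_divide)
  qed
  also have "\<dots> \<le> (1 / of_int (cf_q x k)) / of_int (cf_q x k)"
    using cf_error_le q by (intro divide_right_mono) auto
  also have "\<dots> = 1 / of_int (cf_q x k) ^ 2" by (simp add: power2_eq_square)
  also have "\<dots> \<le> 1 / of_int b ^ 2"
    using \<open>b \<le> cf_q x k\<close> assms(2) by (intro divide_left_mono power_mono) auto
  finally show ?thesis .
qed

end

section \<open>Application to the convergents of a quadratic surd\<close>

theorem theorem4:
  fixes d :: real
  assumes "d \<in> \<rat>" and "d > 0" and "sqrt d \<notin> \<rat>"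
  shows "\<exists>\<eta> > 0. \<exists>\<kappa> > 0. \<exists>N :: real.
           \<forall>\<alpha> \<beta> :: int. \<alpha> > 0 \<and> \<beta> > 0 \<and> coprime \<alpha> \<beta> \<and> is_cf_convergent (sqrt d) \<alpha> \<beta>
              \<and> real_of_int \<alpha> \<ge> N \<and> real_of_int \<beta> \<ge> N \<longrightarrow>
             (\<exists>M :: nat. \<forall>m \<ge> M. \<forall>n :: int.
                \<bar>sqrt d - real_of_int n / real_of_int \<alpha> ^ m\<bar> \<ge> 1 / (\<eta> * real_of_int \<alpha>) ^ m \<and>
                \<bar>sqrt d - real_of_int n / real_of_int \<beta> ^ m\<bar> \<ge> 1 / (\<kappa> * real_of_int \<beta>) ^ m)"
proof -
  obtain a b :: int where b: "b > 0" and d: "d = of_int a / of_int b"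
    using Rats_cases'[OF assms(1)] by blast
  have a: "a > 0" using assms(2) b unfolding d by (simp add: zero_less_divide_iff)
  \<comment> \<open>\<open>U\<close> will bound \<open>u\<close>, through \<open>\<bar>sqrt d -
    \<alpha> / \<beta>\<bar> \<le> 1 / \<beta>\<^sup>2\<close> and
    \<open>sqrt d + \<alpha> / \<beta> \<le> 2 * sqrt d + 1\<close>. \<open>V\<close> dominates both
    choices of \<open>v\<close>: \<open>b\<close> for powers of \<open>\<alpha>\<close> and
    \<open>a\<close> for powers of \<open>\<beta>\<close>.\<close>
  define U where "U = of_int b * (2 * sqrt d + 1)"
  define V where "V = real_of_int (a + b)"
  have "1 * 1 \<le> U" unfolding U_def using b assms(2) by (intro mult_mono) auto
  then have U: "U \<ge> 1" by simp
  have V: "V \<ge> 1" using a b by (simp add: V_def)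
  obtain \<eta> N :: real where "\<eta> > 0" and approx: "\<And>(g::int) (h::int) (c::int) (u::int) (v::int).
     \<lbrakk>of_int g \<ge> N; g > 0; h > 0; c > 0; u \<noteq> 0; \<bar>of_int u\<bar> \<le> U; v > 0; of_int v \<le> V\<rbrakk> \<Longrightarrow>
     \<exists>M. \<forall>m\<ge>M. \<forall>n::int.
        \<bar>of_int (c * g) / of_int h * sqrt (1 + of_int u / of_int (v * g\<^sup>2)) - of_int n / of_int g ^ m\<bar>
          \<ge> 1 / (\<eta> * of_int g) ^ m"
    using sqrt_restricted_approximation[OF U V] by blast
  have main: "\<exists>M. \<forall>m\<ge>M. \<forall>n :: int.
      \<bar>sqrt d - of_int n / of_int \<alpha> ^ m\<bar> \<ge> 1 / (\<eta> * of_int \<alpha>) ^ m \<and>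
      \<bar>sqrt d - of_int n / of_int \<beta> ^ m\<bar> \<ge> 1 / (\<eta> * of_int \<beta>) ^ m"
    if \<alpha>: "\<alpha> > 0" and \<beta>: "\<beta> > 0" and cop: "coprime \<alpha> \<beta>" and conv: "is_cf_convergent (sqrt d) \<alpha> \<beta>"
      and \<alpha>N: "of_int \<alpha> \<ge> N" and \<beta>N: "of_int \<beta> \<ge> N" for \<alpha> \<beta> :: int
  proof -
    define u where "u = a * \<beta>\<^sup>2 - b * \<alpha>\<^sup>2"
    have \<beta>1: "real_of_int \<beta> ^ 2 \<ge> 1" using \<beta> by (simp add: one_le_power)
    have sd: "sqrt d * sqrt d = d" "sqrt d > 0" using assms(2) by auto
    have u_eq: "of_int u = of_int b * of_int \<beta> ^ 2 * ((sqrt d - of_int \<alpha> / of_int \<beta>) * (sqrt d + of_int \<alpha> / of_int \<beta>))"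
    proof -
      have "(sqrt d - of_int \<alpha> / of_int \<beta>) * (sqrt d + of_int \<alpha> / of_int \<beta>) = d - (of_int \<alpha> / of_int \<beta>)\<^sup>2"
        using sd(1) by (simp add: algebra_simps power2_eq_square)
      then show ?thesis unfolding u_def using b \<beta> by (simp add: d power_divide field_simps)
    qed
    have "u \<noteq> 0"
    proof
      assume "u = 0"
      moreover have "sqrt d + of_int \<alpha> / of_int \<beta> > 0" using sd(2) \<alpha> \<beta> by (intro add_pos_pos) auto
      ultimately have "sqrt d = of_int \<alpha> / of_int \<beta>" using u_eq b \<beta> by simp
      then show False using assms(3) by simp
    qed
    have err: "\<bar>sqrt d - of_int \<alpha> / of_int \<beta>\<bar> \<le> 1 / of_int \<beta> ^ 2"
      using cf_convergent_error_le[OF assms(3) conv \<beta> cop] .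
    also have "\<dots> \<le> 1" using \<beta>1 by (simp add: divide_le_eq_1)
    finally have "sqrt d + of_int \<alpha> / of_int \<beta> \<le> 2 * sqrt d + 1" by linarith
    then have "\<bar>sqrt d - of_int \<alpha> / of_int \<beta>\<bar> * \<bar>sqrt d + of_int \<alpha> / of_int \<beta>\<bar> \<le> 1 / of_int \<beta> ^ 2 * (2 * sqrt d + 1)"
      using err sd(2) \<alpha> \<beta> by (intro mult_mono) auto
    then have "of_int b * of_int \<beta> ^ 2 * (\<bar>sqrt d - of_int \<alpha> / of_int \<beta>\<bar> * \<bar>sqrt d + of_int \<alpha> / of_int \<beta>\<bar>)
        \<le> of_int b * of_int \<beta> ^ 2 * (1 / of_int \<beta> ^ 2 * (2 * sqrt d + 1))"
      using b by (intro mult_left_mono) auto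
    moreover have "\<bar>of_int u\<bar> =
        of_int b * of_int \<beta> ^ 2 * (\<bar>sqrt d - of_int \<alpha> / of_int \<beta>\<bar> * \<bar>sqrt d + of_int \<alpha> / of_int \<beta>\<bar>)"
      unfolding u_eq using b by (simp add: abs_mult)
    ultimately have uU: "\<bar>of_int u\<bar> \<le> U" using \<beta> by (simp add: U_def)
    have eq\<alpha>: "of_int (1 * \<alpha>) / of_int \<beta> * sqrt (1 + of_int u / of_int (b * \<alpha>\<^sup>2)) = sqrt d"
    proof -
      have "1 + of_int u / of_int (b * \<alpha>\<^sup>2) = (sqrt d * of_int \<beta> / of_int \<alpha>) ^ 2"
        using \<alpha> b assms(2) by (simp add: u_def d power_divide power_mult_distrib field_simps)
      then have "sqrt (1 + of_int u / of_int (b * \<alpha>\<^sup>2)) = sqrt d * of_int \<beta> / of_int \<alpha>"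
        using sd(2) \<alpha> \<beta> by simp
      then show ?thesis using \<alpha> \<beta> by simp
    qed
    \<comment> \<open>To put \<open>\<beta>\<close> in the numerator, \<open>sqrt d\<close> is
      written as \<open>d / sqrt d\<close> and the inverse surd is expressed by the convergent; this
      changes the sign of \<open>u\<close> and replaces \<open>b\<close> by \<open>a\<close> in the
      argument.\<close>
    have eq\<beta>: "of_int (a * \<beta>) / of_int (b * \<alpha>) * sqrt (1 + of_int (- u) / of_int (a * \<beta>\<^sup>2)) = sqrt d"
    proof -
      have "1 + of_int (- u) / of_int (a * \<beta>\<^sup>2) = (of_int \<alpha> / (sqrt d * of_int \<beta>)) ^ 2"
        using \<beta> a b assms(2) by (simp add: u_def d power_divide power_mult_distrib field_simps)
      then have "sqrt (1 + of_int (- u) / of_int (a * \<beta>\<^sup>2)) = of_int \<alpha> / (sqrt d * of_int \<beta>)"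
        using sd(2) \<alpha> \<beta> by simp
      then have "of_int (a * \<beta>) / of_int (b * \<alpha>) * sqrt (1 + of_int (- u) / of_int (a * \<beta>\<^sup>2)) = d / sqrt d"
        using \<alpha> \<beta> by (simp add: d)
      then show ?thesis using assms(2) by (simp add: real_div_sqrt)
    qed
    obtain M1 where "\<forall>m\<ge>M1. \<forall>n::int. \<bar>sqrt d - of_int n / of_int \<alpha> ^ m\<bar> \<ge> 1 / (\<eta> * of_int \<alpha>) ^ m"
      using approx[of \<alpha> \<beta> 1 u b] \<alpha>N \<alpha> \<beta> \<open>u \<noteq> 0\<close> uU b a unfolding eq\<alpha> by (auto simp: V_def)
    moreover obtain M2 where "\<forall>m\<ge>M2. \<forall>n::int. \<bar>sqrt d - of_int n / of_int \<beta> ^ m\<bar> \<ge> 1 / (\<eta> * of_int \<beta>) ^ m"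
      using approx[of \<beta> "b * \<alpha>" a "- u" a] \<beta>N \<alpha> \<beta> \<open>u \<noteq> 0\<close> uU b a unfolding eq\<beta> by (auto simp: V_def)
    ultimately show ?thesis by (intro exI[of _ "max M1 M2"]) simp
  qed
  show ?thesis
    \<comment> \<open>The same constant serves as \<open>\<eta>\<close> and \<open>\<kappa>\<close>,
      since both cases are instances of one uniform bound.\<close>
    by (intro exI[of _ \<eta>] exI[of _ N] conjI \<open>\<eta> > 0\<close> allI impI) (elim conjE, rule main)
qed

end
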